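(* For every fixed $r\ge3$ and every integer $k\ge r+3$, $$\beta(k,k+r)=\sum_{i=1}^{r}(-1)^{i-1}\binom{r}{i}\,\beta(k-i,k-i+r),$$ where $\beta(k,n)=\dim_{\mathbf{k}}\widetilde H_{n-k-1}(\Delta_k(P_n^2);\mathbf{k})$ for a field $\mathbf{k}$. Equivalently, with $B_r(k)=\beta(k,k+r)$ and $(\nabla f)(k)=f(k)-f(k-1)$, one has $\nabla^rB_r(k)=\sum_{i=0}^r(-1)^i\binom{r}{i}B_r(k-i)=0$.
   Context: For a finite simple graph $G$ on $[n]=\{1,\dots,n\}$ and $2\le k\le n$, the $k$-cut complex $\Delta_k(G)$ is the simplicial complex on $[n]$ whose facets are the sets $[n]\setminus T$, where $T$ ranges over the $k$-element subsets of $[n]$ with $G[T]$ disconnected. The squared path $P_n^2$ is the graph on $[n]$ whose edges are the pairs $\{i,i+1\}$ ($1\le i\le n-1$) and $\{i,i+2\}$ ($1\le i\le n-2$). $\widetilde H$ denotes reduced simplicial homology. *)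

theory Defs
  imports "HOL-Algebra.AbelCoset" "Graph_Theory.Digraph_Component" "Jordan_Normal_Form.VS_Connect"
begin

section \<open>Quotients of modules\<close>

text \<open>
  The quotient of a module \<open>M\<close> by a submodule \<open>N\<close>, as the set of cosets of \<open>N\<close>. The fields \<open>mult\<close> and
  \<open>one\<close>, which the record type inherits from rings, play no role in a module.
\<close>

definition quotient_module :: "('r, 'm) module \<Rightarrow> 'm set \<Rightarrow> ('r, 'm set) module" where
  "quotient_module M N =
    \<lparr>carrier = a_rcosets\<^bsub>M\<^esub> N,
     monoid.mult = (\<lambda>_ _. N), one = N,
     zero = N,
     add = (\<lambda>X Y. X <+>\<^bsub>M\<^esub> Y),
     smult = (\<lambda>a X. \<Union>x\<in>X. N +>\<^bsub>M\<^esub> (a \<odot>\<^bsub>M\<^esub> x))\<rparr>"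


section \<open>Reduced simplicial homology over a field\<close>

text \<open>
  A simplicial complex is a set \<open>K\<close> of finite sets (its faces) that is closed under taking subsets;
  below, \<open>K\<close> is always finite. Chains are functions on faces. The empty set is a face of
  dimension \<open>-1\<close>, so the chain complex is the augmented one and its homology is the reduced homology;
  accordingly, degrees are integers. The vertices are linearly ordered, and each face is oriented by
  this order.
\<close>

definition chain_module :: "'a set set \<Rightarrow> int \<Rightarrow> ('k::field, 'a set \<Rightarrow> 'k) module" where
  "chain_module K d =
    \<lparr>carrier = {c. \<forall>\<sigma>. c \<sigma> \<noteq> 0 \<longrightarrow> \<sigma> \<in> K \<and> int (card \<sigma>) = d + 1},
     monoid.mult = (\<lambda>_ _ _. 0), one = (\<lambda>_. 0),
     zero = (\<lambda>_. 0),
     add = (\<lambda>b c \<sigma>. b \<sigma> + c \<sigma>),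
     smult = (\<lambda>a c \<sigma>. a * c \<sigma>)\<rparr>"

text \<open>
  The linear map that sends a face \<open>\<sigma> = {v\<^sub>0 < \<dots> < v\<^sub>d}\<close> to the alternating sum of the \<open>\<sigma> - {v\<^sub>i}\<close> with
  signs \<open>(-1)\<^sup>i\<close>; note that \<open>i\<close> is the number of vertices of \<open>\<sigma>\<close> below \<open>v\<^sub>i\<close>.
\<close>

definition boundary_map ::
    "'a::linorder set set \<Rightarrow> ('a set \<Rightarrow> 'k::field) \<Rightarrow> ('a set \<Rightarrow> 'k)" where
  "boundary_map K c =
    (\<lambda>\<tau>. \<Sum>\<sigma>\<in>K. \<Sum>v\<in>\<sigma>. if \<tau> = \<sigma> - {v} then (-1) ^ card {w \<in> \<sigma>. w < v} * c \<sigma> else 0)"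

definition cycles :: "'a::linorder set set \<Rightarrow> int \<Rightarrow> ('a set \<Rightarrow> 'k::field) set" where
  "cycles K d = {c \<in> carrier (chain_module K d). boundary_map K c = (\<lambda>_. 0)}"

definition boundaries :: "'a::linorder set set \<Rightarrow> int \<Rightarrow> ('a set \<Rightarrow> 'k::field) set" where
  "boundaries K d = boundary_map K ` carrier (chain_module K (d + 1))"

definition reduced_homology ::
    "'a::linorder set set \<Rightarrow> int \<Rightarrow> ('k::field, ('a set \<Rightarrow> 'k) set) module" where
  "reduced_homology K d =
    quotient_module ((chain_module K d)\<lparr>carrier := cycles K d\<rparr>) (boundaries K d)"

definition reduced_betti :: "'k::field itself \<Rightarrow> 'a::linorder set set \<Rightarrow> int \<Rightarrow> nat" where
  "reduced_betti _ K d =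
    vectorspace.dim class_ring (reduced_homology K d :: ('k, ('a set \<Rightarrow> 'k) set) module)"


section \<open>Cut complexes and squared paths\<close>

text \<open>
  Simple graphs are represented as in \<^theory>\<open>Graph_Theory.Digraph\<close>: an edge \<open>{u, v}\<close> is the pair of
  arcs \<open>(u, v)\<close> and \<open>(v, u)\<close>.
\<close>

definition cut_facets :: "'a pair_pre_digraph \<Rightarrow> nat \<Rightarrow> 'a set set" where
  "cut_facets G k =
    {pverts G - T | T. T \<subseteq> pverts G \<and> card T = k \<and> \<not> connected (with_proj G \<restriction> T)}"

definition cut_complex :: "'a pair_pre_digraph \<Rightarrow> nat \<Rightarrow> 'a set set" where
  "cut_complex G k = {\<sigma>. \<exists>F \<in> cut_facets G k. \<sigma> \<subseteq> F}"

definition squared_path :: "nat \<Rightarrow> nat pair_pre_digraph" where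
  "squared_path n =
    \<lparr>pverts = {1..n},
     parcs = {(i, j). i \<in> {1..n} \<and> j \<in> {1..n} \<and> (j = i + 1 \<or> j = i + 2 \<or> i = j + 1 \<or> i = j + 2)}\<rparr>"

lemma pair_graph_squared_path: "pair_graph (squared_path n)"
proof
  show "finite (parcs (squared_path n))"
    by (rule finite_subset[of _ "{1..n} \<times> {1..n}"]) (auto simp: squared_path_def)
qed (auto simp: squared_path_def symmetric_def sym_def)

definition cut_betti :: "'k::field itself \<Rightarrow> nat \<Rightarrow> nat \<Rightarrow> nat" where
  "cut_betti F k n = reduced_betti F (cut_complex (squared_path n) k) (int n - int k - 1)"

definition cut_betti_diag :: "'k::field itself \<Rightarrow> nat \<Rightarrow> nat \<Rightarrow> int" where
  "cut_betti_diag F r k = int (cut_betti F k (k + r))"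

text \<open>
  The argument is a natural number, so \<open>backward_diff f 0 = 0\<close> by truncated subtraction; the value
  of an \<open>r\<close>-fold iterate at \<open>k\<close> is the intended one for \<open>k \<ge> r\<close>.
\<close>

definition backward_diff :: "(nat \<Rightarrow> int) \<Rightarrow> nat \<Rightarrow> int" where
  "backward_diff f k = f k - f (k - 1)"

end

theory Submission
  imports Defs
begin

text \<open>
  Write \<open>n = k + r\<close>. Since the facets have \<open>r\<close> elements, the homology in question is the space of top
  cycles. A \<open>k\<close>-set is connected in the squared path iff it is gapless (consecutive elements differ
  by at most 2), so the cycles are the solutions of a linear system whose unknowns are the \<open>r\<close>-sets
  with non-gapless complement and whose equations are the boundary coefficients. As \<open>\<partial>\<partial> = 0\<close>, the
  \<open>(n - 1 choose r - 1)\<close> equations at the \<open>(r - 1)\<close>-sets avoiding \<open>n\<close> suffice. The complements of the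
  \<open>r\<close> intervals of length \<open>k + 1\<close> are not faces, and this makes exactly \<open>r\<close> of these equations redundant.

  A linear relation between the remaining equations is a cochain whose coboundary, viewed on the
  complements, is supported on gapless \<open>k\<close>-sets and is again a cocycle. Deleting an interior point of a
  gapless set leaves few ways to restore a gapless set. So the coboundary vanishes on sets with two
  missing interior points; for fixed \<open>a\<close> it vanishes on all sets \<open>{a..a + k} - {h}\<close> once it vanishes on
  one of them; and, as \<open>k \<ge> 3\<close>, its vanishing on these forces it to vanish on intervals.

  Hence the Betti number is \<open>(n - 1 choose r) - G + r\<close>, where \<open>G\<close> counts the gapless \<open>k\<close>-sets,
  \<open>G = (\<Sum>j\<le>r. \<Sum>i\<le>j. k - 1 choose i)\<close>. In \<open>k\<close>, both \<open>(n - 1 choose r)\<close> and \<open>G\<close> are polynomials of degree \<open>r\<close>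
  with leading coefficient \<open>1 / r!\<close>, so the \<open>r\<close>-th difference of the Betti number vanishes.
\<close>

section \<open>Solution spaces of independent linear equations\<close>

lemma independent_equations_solution_coordinates:
  fixes a :: "'c \<Rightarrow> 'u \<Rightarrow> 'k::field"
  assumes "finite C" and "finite U"
    and "\<And>\<phi>. (\<And>u. u \<in> U \<Longrightarrow> (\<Sum>c\<in>C. \<phi> c * a c u) = 0) \<Longrightarrow> \<forall>c\<in>C. \<phi> c = 0"
  shows "\<exists>D\<subseteq>U. card D + card C = card U \<and>
    (\<forall>h. \<exists>!f. (\<forall>u. u \<notin> U \<longrightarrow> f u = 0) \<and> (\<forall>c\<in>C. (\<Sum>u\<in>U. a c u * f u) = 0) \<and> (\<forall>u\<in>D. f u = h u))"
  using assms
proof (induction C arbitrary: U a rule: finite_induct)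
  case empty
  have "\<exists>!f. (\<forall>u. u \<notin> U \<longrightarrow> f u = 0) \<and> (\<forall>u\<in>U. f u = h u)" for h :: "'u \<Rightarrow> 'k"
    by (rule ex1I[of _ "\<lambda>u. if u \<in> U then h u else 0"]) (simp, rule ext, simp)
  then show ?case by (intro exI[of _ U]) simp
next
  case (insert c0 C)
  have "\<exists>u0\<in>U. a c0 u0 \<noteq> 0"
  proof (rule ccontr)
    assume *: "\<not> (\<exists>u0\<in>U. a c0 u0 \<noteq> 0)"
    have "(\<Sum>c\<in>insert c0 C. (if c = c0 then 1 else 0) * a c u) = 0" if "u \<in> U" for u
      using that * by (intro sum.neutral) auto
    from insert.prems(2)[OF this] show False by auto
  qed
  then obtain u0 where u0: "u0 \<in> U" "a c0 u0 \<noteq> 0" by blast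
  define q where "q c = a c u0 / a c0 u0" for c
  define a' where "a' c u = a c u - q c * a c0 u" for c u
  let ?U = "U - {u0}"
  have a'0: "a' c u0 = 0" for c using u0 by (simp add: a'_def q_def)
  have indep: "\<forall>c\<in>C. \<phi> c = 0" if \<phi>: "\<And>u. u \<in> ?U \<Longrightarrow> (\<Sum>c\<in>C. \<phi> c * a' c u) = 0" for \<phi>
  proof -
    \<comment> \<open>A relation between the reduced equations lifts to the original ones: the
      coefficient of \<open>c0\<close> collects the multiples of that equation subtracted in
      \<open>a'\<close>.\<close>
    define \<psi> where "\<psi> = \<phi>(c0 := - (\<Sum>c\<in>C. \<phi> c * q c))"
    have "(\<Sum>c\<in>insert c0 C. \<psi> c * a c u) = 0" if "u \<in> U" for u
    proof -
      have "(\<Sum>c\<in>C. \<psi> c * a c u) = (\<Sum>c\<in>C. \<phi> c * a c u)"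
        using insert.hyps by (intro sum.cong) (auto simp: \<psi>_def)
      moreover have "\<psi> c0 = - (\<Sum>c\<in>C. \<phi> c * q c)" by (simp add: \<psi>_def)
      ultimately have "(\<Sum>c\<in>insert c0 C. \<psi> c * a c u) =
          - (\<Sum>c\<in>C. \<phi> c * q c) * a c0 u + (\<Sum>c\<in>C. \<phi> c * a c u)"
        by (simp only: sum.insert[OF insert.hyps(1,2)])
      also have "\<dots> = (\<Sum>c\<in>C. \<phi> c * a' c u)"
        by (simp add: a'_def sum_subtractf right_diff_distrib sum_distrib_right mult.assoc)
      also have "\<dots> = 0" using \<phi>[of u] that a'0 by (cases "u = u0") auto
      finally show ?thesis .
    qed
    from insert.prems(2)[OF this] have "\<forall>c\<in>insert c0 C. \<psi> c = 0" .
    then have "\<psi> c = 0" if "c \<in> C" for c using that by simp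
    moreover have "\<psi> c = \<phi> c" if "c \<in> C" for c
      using that insert.hyps by (auto simp: \<psi>_def)
    ultimately show ?thesis by simp
  qed
  have "\<exists>D\<subseteq>?U. card D + card C = card ?U \<and>
    (\<forall>h. \<exists>!f. (\<forall>u. u \<notin> ?U \<longrightarrow> f u = 0) \<and> (\<forall>c\<in>C. (\<Sum>u\<in>?U. a' c u * f u) = 0) \<and> (\<forall>u\<in>D. f u = h u))"
    by (rule insert.IH[OF finite_Diff[OF insert.prems(1)]]) (rule indep)
  then obtain D where D: "D \<subseteq> ?U" "card D + card C = card ?U" and
    ex1: "\<And>h. \<exists>!f. (\<forall>u. u \<notin> ?U \<longrightarrow> f u = 0) \<and> (\<forall>c\<in>C. (\<Sum>u\<in>?U. a' c u * f u) = 0) \<and> (\<forall>u\<in>D. f u = h u)"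
    by (elim exE conjE) (rule that, assumption+, erule spec)
  have split: "(\<Sum>u\<in>U. g u) = g u0 + (\<Sum>u\<in>?U. g u)" for g :: "'u \<Rightarrow> 'k"
    using u0 insert.prems(1) by (simp add: sum.remove)
  have equiv: "(\<forall>c\<in>insert c0 C. (\<Sum>u\<in>U. a c u * f u) = 0) \<longleftrightarrow>
      (\<Sum>u\<in>U. a c0 u * f u) = 0 \<and> (\<forall>c\<in>C. (\<Sum>u\<in>?U. a' c u * f u) = 0)" for f
  proof -
    have "(\<Sum>u\<in>?U. a' c u * f u) = (\<Sum>u\<in>U. a c u * f u) - q c * (\<Sum>u\<in>U. a c0 u * f u)" for c
    proof -
      have "(\<Sum>u\<in>?U. a' c u * f u) = (\<Sum>u\<in>U. a' c u * f u)" by (simp add: split a'0)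
      also have "\<dots> = (\<Sum>u\<in>U. a c u * f u) - q c * (\<Sum>u\<in>U. a c0 u * f u)"
        by (simp add: a'_def left_diff_distrib sum_subtractf sum_distrib_left mult.assoc)
      finally show ?thesis .
    qed
    then show ?thesis by auto
  qed
  have pivot: "(\<Sum>u\<in>U. a c0 u * f u) = 0 \<longleftrightarrow> f u0 = - (\<Sum>u\<in>?U. a c0 u * f u) / a c0 u0" for f
  proof -
    have "(\<Sum>u\<in>U. a c0 u * f u) = 0 \<longleftrightarrow> f u0 * a c0 u0 = - (\<Sum>u\<in>?U. a c0 u * f u)"
      by (simp only: split[of "\<lambda>u. a c0 u * f u"] add_eq_0_iff2) (simp add: mult.commute)
    also have "\<dots> \<longleftrightarrow> f u0 = - (\<Sum>u\<in>?U. a c0 u * f u) / a c0 u0"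
      using u0 by (simp only: eq_divide_eq) simp
    finally show ?thesis .
  qed
  have "\<exists>!f. (\<forall>u. u \<notin> U \<longrightarrow> f u = 0) \<and> (\<forall>c\<in>insert c0 C. (\<Sum>u\<in>U. a c u * f u) = 0) \<and> (\<forall>u\<in>D. f u = h u)"
    for h
  proof -
    let ?P = "\<lambda>f. (\<forall>u. u \<notin> ?U \<longrightarrow> f u = 0) \<and> (\<forall>c\<in>C. (\<Sum>u\<in>?U. a' c u * f u) = 0) \<and> (\<forall>u\<in>D. f u = h u)"
    let ?Q = "\<lambda>f. (\<forall>u. u \<notin> U \<longrightarrow> f u = 0) \<and> (\<forall>c\<in>insert c0 C. (\<Sum>u\<in>U. a c u * f u) = 0) \<and> (\<forall>u\<in>D. f u = h u)"
    have u0D: "u0 \<notin> D" using D by auto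
    have upd: "(\<Sum>u\<in>?U. g u * (f(u0 := x)) u) = (\<Sum>u\<in>?U. g u * f u)" for g f :: "'u \<Rightarrow> 'k" and x
      by (intro sum.cong) auto
    from ex1[of h] obtain f where f': "?P f \<and> (\<forall>g. ?P g \<longrightarrow> g = f)"
      unfolding Ex1_def by (rule exE)
    note f = f'[THEN conjunct1] and uniq = f'[THEN conjunct2, rule_format]
    \<comment> \<open>Back-substitution: equation \<open>c0\<close> dictates the value at the pivot
      \<open>u0\<close>.\<close>
    have 1: "?Q (f(u0 := - (\<Sum>u\<in>?U. a c0 u * f u) / a c0 u0))"
      unfolding equiv pivot upd
    proof (intro conjI)
      show "\<forall>u. u \<notin> U \<longrightarrow> (f(u0 := x)) u = 0" for x
        using f[THEN conjunct1] u0(1) by auto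
      show "\<forall>u\<in>D. (f(u0 := x)) u = h u" for x
        using f[THEN conjunct2, THEN conjunct2] u0D by auto
      show "\<forall>c\<in>C. (\<Sum>u\<in>?U. a' c u * f u) = 0"
        using f[THEN conjunct2, THEN conjunct1] .
    qed simp
    have 2: "f1 = f2" if f1: "?Q f1" and f2: "?Q f2" for f1 f2
    proof -
      \<comment> \<open>\<open>?P\<close> demands zero outside \<open>?U\<close>, so
        \<open>uniq\<close> applies only after the pivot value is reset to 0.\<close>
      have P: "?P (g(u0 := 0))" if "?Q g" for g
      proof (intro conjI)
        show "\<forall>u. u \<notin> ?U \<longrightarrow> (g(u0 := 0)) u = 0" using that[THEN conjunct1] by auto
        show "\<forall>c\<in>C. (\<Sum>u\<in>?U. a' c u * (g(u0 := 0)) u) = 0"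
          unfolding upd using that unfolding equiv by (elim conjE)
        show "\<forall>u\<in>D. (g(u0 := 0)) u = h u"
          using that[THEN conjunct2, THEN conjunct2] u0D by auto
      qed
      have eq: "f1(u0 := 0) = f2(u0 := 0)" 
        by (rule trans[OF uniq[OF P[OF f1]] uniq[OF P[OF f2], symmetric]])
      then have eq': "f1 u = f2 u" if "u \<noteq> u0" for u
      proof -
        have "(f1(u0 := 0)) u = (f2(u0 := 0)) u" by (simp only: eq)
        then show ?thesis using that by simp
      qed
      have val: "g u0 = - (\<Sum>u\<in>?U. a c0 u * g u) / a c0 u0" if "?Q g" for g
        using that unfolding equiv pivot by (elim conjE)
      have "(\<Sum>u\<in>?U. a c0 u * f1 u) = (\<Sum>u\<in>?U. a c0 u * f2 u)"
        by (rule sum.cong) (simp_all add: eq')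
      then have "f1 u0 = f2 u0" unfolding val[OF f1] val[OF f2] by simp
      with eq' have "f1 u = f2 u" for u by (cases "u = u0") simp_all
      then show ?thesis by (rule ext)
    qed
    show ?thesis
    proof (rule ex1I, rule 1)
      fix g assume g: "?Q g"
      show "g = f(u0 := - (\<Sum>u\<in>?U. a c0 u * f u) / a c0 u0)" by (rule 2, rule g, rule 1)
    qed
  qed
  note ex1_insert = this
  have card_insert: "card D + card (insert c0 C) = card U"
    using D(2) card_Suc_Diff1[OF insert.prems(1) u0(1)] card_insert_disjoint[OF insert.hyps] by linarith
  have "D \<subseteq> U" using D by blast
  show ?case
    by (rule exI[of _ D], rule conjI[OF \<open>D \<subseteq> U\<close>], rule conjI[OF card_insert], rule allI, rule ex1_insert)
qed

section \<open>Dimension of a quotient by the zero subspace\<close>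

text \<open>Cosets of the zero subspace are singletons, so the operations are those on the
  representatives.\<close>

lemma vectorspace_quotient_by_zero:
  fixes Z :: "('a set \<Rightarrow> 'k::field) set" and K :: "'a set set" and d :: int
  assumes Z0: "(\<lambda>_. 0) \<in> Z"
    and Zadd: "\<And>f g. f \<in> Z \<Longrightarrow> g \<in> Z \<Longrightarrow> (\<lambda>u. f u + g u) \<in> Z"
    and Zsmult: "\<And>x f. f \<in> Z \<Longrightarrow> (\<lambda>u. x * f u) \<in> Z"
  defines "Q \<equiv> quotient_module ((chain_module K d)\<lparr>carrier := Z\<rparr>) {\<lambda>_. 0}"
  shows "carrier Q = (\<lambda>f. {f}) ` Z" "zero Q = {\<lambda>_. 0}"
    "add Q {f} {g} = {\<lambda>u. f u + g u}" "module.smult Q x {f} = {\<lambda>u. x * f u}"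
    "vectorspace class_ring Q"
proof -
  show c: "carrier Q = (\<lambda>f. {f}) ` Z"
    by (auto simp: Q_def quotient_module_def A_RCOSETS_def RCOSETS_def r_coset_def chain_module_def)
  show z: "zero Q = {\<lambda>_. 0}" by (simp add: Q_def quotient_module_def)
  have a: "add Q {f} {g} = {\<lambda>u. f u + g u}" for f g
    by (auto simp: Q_def quotient_module_def set_add_def set_mult_def chain_module_def)
  have s: "module.smult Q x {f} = {\<lambda>u. x * f u}" for x f
    by (auto simp: Q_def quotient_module_def a_r_coset_def r_coset_def chain_module_def)
  show "add Q {f} {g} = {\<lambda>u. f u + g u}" "module.smult Q x {f} = {\<lambda>u. x * f u}" by (fact a s)+
  interpret abelian_group Q
  proof (rule abelian_groupI)
    fix X assume "X \<in> carrier Q"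
    then obtain f where f: "f \<in> Z" "X = {f}" by (auto simp: c)
    then have "add Q {\<lambda>u. (-1) * f u} X = zero Q" by (simp add: a z)
    with f Zsmult[of f "-1"] show "\<exists>Y\<in>carrier Q. add Q Y X = zero Q" by (auto simp: c)
  qed (auto simp: c a z Z0 Zadd add_ac)
  show "vectorspace class_ring Q"
    unfolding vectorspace_def
    by (intro conjI class_field, unfold_locales) (auto simp: c a s Zsmult algebra_simps)
qed

text \<open>Unique extension from \<open>D\<close> identifies the quotient with the vectors of
  length \<open>card D\<close>. The map \<open>L\<close> is linear because the sum of two extensions
  lies in \<open>Z\<close> and has the right values on \<open>D\<close>, hence is the extension of
  the sum; likewise for multiples.\<close>

lemma dim_quotient_by_zero:
  fixes Z :: "('a set \<Rightarrow> 'k::field) set" and K :: "'a set set" and d :: int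
  assumes Z: "(\<lambda>_. 0) \<in> Z"
    "\<And>f g. f \<in> Z \<Longrightarrow> g \<in> Z \<Longrightarrow> (\<lambda>u. f u + g u) \<in> Z"
    "\<And>x f. f \<in> Z \<Longrightarrow> (\<lambda>u. x * f u) \<in> Z"
    and D: "finite D" and ex1: "\<And>h. \<exists>!f. f \<in> Z \<and> (\<forall>u\<in>D. f u = h u)"
  shows "vectorspace.dim class_ring (quotient_module ((chain_module K d)\<lparr>carrier := Z\<rparr>) {\<lambda>_. 0}) = card D"
proof -
  define Q where "Q = quotient_module ((chain_module K d)\<lparr>carrier := Z\<rparr>) {\<lambda>_. 0}"
  note Q = vectorspace_quotient_by_zero[of Z K d, OF Z, folded Q_def]
  obtain i where i: "bij_betw i D {0..<card D}"
    using ex_bij_betw_finite_nat[OF D] by blast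
  define ext where "ext h = (THE f. f \<in> Z \<and> (\<forall>u\<in>D. f u = h u))" for h
  have ext: "ext h \<in> Z" "u \<in> D \<Longrightarrow> ext h u = h u" for h u
    using theI'[OF ex1[of h]] by (auto simp: ext_def)
  have extI: "ext h = f" if "f \<in> Z" "\<And>u. u \<in> D \<Longrightarrow> f u = h u" for f h
    unfolding ext_def using that by (intro the1_equality[OF ex1]) simp
  let ?m = "card D"
  define L where "L v = {ext (\<lambda>u. v $ i u)}" for v :: "'k Matrix.vec"
  have iD: "i u < ?m" if "u \<in> D" for u using i that by (auto simp: bij_betw_def)
  have lin: "linear_map class_ring (module_vec TYPE('k) ?m) Q L"
    unfolding linear_map_def mod_hom_def mod_hom_axioms_def
  proof (intro conjI)
    show "vectorspace class_ring (module_vec TYPE('k) ?m)" by (rule vec_vs)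
    show Qv: "vectorspace class_ring Q" by (rule Q(5))
    show "module class_ring (module_vec TYPE('k) ?m)" by (rule vec_module)
    show "module class_ring Q" using Qv by (simp add: vectorspace_def)
    have "ext (\<lambda>u. (v + w) $ i u) = (\<lambda>u. ext (\<lambda>u. v $ i u) u + ext (\<lambda>u. w $ i u) u)"
      if "v \<in> carrier_vec ?m" "w \<in> carrier_vec ?m" for v w
      using that by (intro extI Z(2)) (auto simp: ext iD)
    then have "L (v + w) = add Q (L v) (L w)" if "v \<in> carrier_vec ?m" "w \<in> carrier_vec ?m" for v w
      using that by (simp only: L_def Q(3))
    moreover have "ext (\<lambda>u. (x \<cdot>\<^sub>v v) $ i u) = (\<lambda>u. x * ext (\<lambda>u. v $ i u) u)"
      if "v \<in> carrier_vec ?m" for x v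
      using that by (intro extI Z(3)) (auto simp: ext iD)
    then have "L (x \<cdot>\<^sub>v v) = module.smult Q x (L v)" if "v \<in> carrier_vec ?m" for x v
      using that by (simp only: L_def Q(4))
    moreover have "L v \<in> carrier Q" for v by (simp add: L_def Q(1) ext)
    ultimately show "L \<in> module_hom class_ring (module_vec TYPE('k) ?m) Q"
      by (simp add: module_hom_def module_vec_simps)
  qed
  have "inj_on L (carrier (module_vec TYPE('k) ?m))"
  proof (rule inj_onI)
    fix v w assume v: "v \<in> carrier (module_vec TYPE('k) ?m)" and w: "w \<in> carrier (module_vec TYPE('k) ?m)"
      and "L v = L w"
    then have "ext (\<lambda>u. v $ i u) = ext (\<lambda>u. w $ i u)" by (simp add: L_def)
    then have *: "v $ i u = w $ i u" if "u \<in> D" for u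
      using ext(2)[of u "\<lambda>u. v $ i u"] ext(2)[of u "\<lambda>u. w $ i u"] that by simp
    show "v = w"
    proof (rule eq_vecI)
      fix j assume "j < dim_vec w"
      moreover have "dim_vec w = ?m" using w by (simp add: module_vec_simps)
      ultimately have "j \<in> i ` D" using i by (simp add: bij_betw_def)
      then obtain u where "u \<in> D" "j = i u" by blast
      then show "v $ j = w $ j" by (simp add: *)
    next
      show "dim_vec v = dim_vec w" using v w by (simp add: module_vec_simps)
    qed
  qed
  moreover have "L ` carrier (module_vec TYPE('k) ?m) = carrier Q"
  proof -
    have "\<exists>v\<in>carrier_vec ?m. L v = {f}" if f: "f \<in> Z" for f
    proof
      show "Matrix.vec ?m (\<lambda>j. f (the_inv_into D i j)) \<in> carrier_vec ?m" by simp
      have "ext (\<lambda>u. Matrix.vec ?m (\<lambda>j. f (the_inv_into D i j)) $ i u) = f"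
        using i f iD by (intro extI) (simp_all add: bij_betw_def the_inv_into_f_f)
      then show "L (Matrix.vec ?m (\<lambda>j. f (the_inv_into D i j))) = {f}" by (simp add: L_def)
    qed
    then show ?thesis by (auto simp: Q(1) L_def ext module_vec_simps image_iff)
  qed
  ultimately have "vectorspace.dim class_ring (module_vec TYPE('k) ?m) = vectorspace.dim class_ring Q"
    by (rule linear_map.dim_eq[OF lin vec_space.fin_dim])
  then show ?thesis by (simp add: vec_space.dim_is_n Q_def)
qed

section \<open>Gapless sets\<close>

definition hole :: "nat set \<Rightarrow> nat \<Rightarrow> bool" where
  "hole T h \<longleftrightarrow> h \<notin> T \<and> (\<exists>x\<in>T. x < h) \<and> (\<exists>y\<in>T. h < y)"

text \<open>This form suits the vanishing arguments, where one hole followed by a missing point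
  refutes it; \<open>gapless_alt\<close> is the form used for connectivity and counting.\<close>

definition gapless :: "nat set \<Rightarrow> bool" where
  "gapless T \<longleftrightarrow> (\<forall>h. hole T h \<longrightarrow> Suc h \<in> T)"

lemma gapless_alt: "gapless T \<longleftrightarrow> (\<forall>x\<in>T. (\<exists>y\<in>T. x < y) \<longrightarrow> x + 1 \<in> T \<or> x + 2 \<in> T)"
proof
  assume g: "gapless T"
  show "\<forall>x\<in>T. (\<exists>y\<in>T. x < y) \<longrightarrow> x + 1 \<in> T \<or> x + 2 \<in> T"
  proof (intro ballI impI)
    fix x assume x: "x \<in> T" and "\<exists>y\<in>T. x < y"
    then obtain y where y: "y \<in> T" "x < y" by blast
    show "x + 1 \<in> T \<or> x + 2 \<in> T"
    proof (cases "x + 1 \<in> T")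
      case False
      then have "y \<noteq> x + 1" using y by auto
      then have "hole T (x + 1)" unfolding hole_def using x y False
        by (intro conjI bexI[of _ x] bexI[of _ y]) auto
      then show ?thesis using g by (auto simp: gapless_def)
    qed simp
  qed
next
  assume *: "\<forall>x\<in>T. (\<exists>y\<in>T. x < y) \<longrightarrow> x + 1 \<in> T \<or> x + 2 \<in> T"
  show "gapless T" unfolding gapless_def
  proof (intro allI impI)
    fix h assume h: "hole T h"
    \<comment> \<open>The element of \<open>T\<close> just below the hole. The step condition at
      \<open>x\<close> then forces \<open>h = x + 1\<close> and
      \<open>x + 2 \<in> T\<close>.\<close>
    define x where "x = Max {x \<in> T. x < h}"
    have "finite {x \<in> T. x < h}" "{x \<in> T. x < h} \<noteq> {}" using h by (auto simp: hole_def)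
    then have x: "x \<in> T" "x < h" and max: "\<And>z. z \<in> T \<Longrightarrow> z < h \<Longrightarrow> z \<le> x"
      using Max_in[of "{x \<in> T. x < h}"] Max_ge[of "{x \<in> T. x < h}"] by (auto simp: x_def)
    obtain y where y: "y \<in> T" "h < y" using h by (auto simp: hole_def)
    have "\<exists>y\<in>T. x < y" using y x(2) by (intro bexI[of _ y]) auto
    then have "x + 1 \<in> T \<or> x + 2 \<in> T" using * x by blast
    moreover have h': "h \<notin> T" using h by (simp add: hole_def)
    ultimately show "Suc h \<in> T"
    proof (elim disjE)
      assume "x + 1 \<in> T"
      moreover from this have "\<not> x + 1 < h" using max[of "x + 1"] by auto
      ultimately have "h \<in> T" using x(2) by (cases "h = x + 1") auto
      with h' show ?thesis ..
    next
      assume x2: "x + 2 \<in> T"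
      then have "\<not> x + 2 < h" using max[of "x + 2"] by auto
      moreover have "h \<noteq> x + 2" using x2 h' by auto
      ultimately have "Suc h = x + 2" using x(2) by simp
      with x2 show ?thesis by simp
    qed
  qed
qed

lemma not_gaplessI: "hole T h \<Longrightarrow> Suc h \<notin> T \<Longrightarrow> \<not> gapless T"
  by (auto simp: gapless_def)

lemma holeI: "h \<notin> T \<Longrightarrow> x \<in> T \<Longrightarrow> x < h \<Longrightarrow> y \<in> T \<Longrightarrow> h < y \<Longrightarrow> hole T h"
  by (auto simp: hole_def)

text \<open>Used to identify sets with few holes: without holes \<open>T\<close> is an interval,
  with one hole an interval minus a point.\<close>

lemma eq_atLeastAtMost_diff_holes:
  assumes "finite T" "T \<noteq> {}"
  shows "T = {Min T..Max T} - {h. hole T h}"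
proof (intro equalityI subsetI)
  fix x assume "x \<in> T"
  then show "x \<in> {Min T..Max T} - {h. hole T h}" using assms by (simp add: hole_def)
next
  fix x assume x: "x \<in> {Min T..Max T} - {h. hole T h}"
  show "x \<in> T"
  proof (rule ccontr)
    assume "x \<notin> T"
    then have "x \<noteq> Min T" "x \<noteq> Max T" using Min_in[OF assms] Max_in[OF assms] by metis+
    then have "hole T x" using x \<open>x \<notin> T\<close>
      by (intro holeI[OF _ Min_in[OF assms] _ Max_in[OF assms]]) auto
    with x show False by simp
  qed
qed

text \<open>The family \<open>\<Psi>\<close> is a coboundary \<open>\<psi>\<close> re-indexed by complements, \<open>\<Psi> T = \<psi> ({1..n} - T)\<close>, and the signs
  \<open>\<epsilon>\<close> enter only through being nonzero. The two base cases are the normalisations that come from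
  dropping the redundant equations.\<close>

locale gapless_cocycle =
  fixes n k :: nat and \<epsilon> :: "nat set \<Rightarrow> nat \<Rightarrow> 'k::field" and \<Psi> :: "nat set \<Rightarrow> 'k"
  assumes k: "k \<ge> 3"
    and support: "\<Psi> T \<noteq> 0 \<Longrightarrow> T \<subseteq> {1..n} \<and> card T = k \<and> gapless T"
    and sign: "W \<subseteq> {1..n} \<Longrightarrow> s \<in> {1..n} - W \<Longrightarrow> \<epsilon> W s \<noteq> 0"
    and cocycle: "W \<subseteq> {1..n} \<Longrightarrow> Suc (card W) = k \<Longrightarrow>
      (\<Sum>s\<in>{1..n} - W. \<epsilon> W s * \<Psi> (insert s W)) = 0"
    and base_hole: "1 \<le> a \<Longrightarrow> a + k < n \<Longrightarrow> \<Psi> ({a..a + k} - {a + k - 1}) = 0"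
    and base_interval: "\<Psi> {n - k..<n} = 0"
begin

text \<open>In the cocycle relation at \<open>T - {t}\<close> only the term of \<open>t\<close>
  survives, and its sign is nonzero. The point \<open>t\<close> will be chosen so that few
  replacements give a gapless set.\<close>

lemma exchange:
  assumes t: "t \<in> T" and zero: "\<And>s. s \<in> {1..n} \<Longrightarrow> s \<notin> T \<Longrightarrow> \<Psi> (insert s (T - {t})) = 0"
  shows "\<Psi> T = 0"
proof (rule ccontr)
  assume nz: "\<Psi> T \<noteq> 0"
  from support[OF nz] have T: "T \<subseteq> {1..n}" "card T = k" "finite T"
    using finite_subset by blast+
  let ?W = "T - {t}"
  have W: "?W \<subseteq> {1..n}" "Suc (card ?W) = k" "t \<in> {1..n} - ?W" "insert t ?W = T"
    using T t card_Suc_Diff1[OF T(3) t] by auto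
  have "(\<Sum>s\<in>{1..n} - ?W. \<epsilon> ?W s * \<Psi> (insert s ?W)) = \<epsilon> ?W t * \<Psi> (insert t ?W)"
  proof -
    have "(\<Sum>s\<in>{1..n} - ?W - {t}. \<epsilon> ?W s * \<Psi> (insert s ?W)) = 0"
    proof (rule sum.neutral, rule ballI)
      fix s assume s: "s \<in> {1..n} - ?W - {t}"
      have "\<Psi> (insert s ?W) = 0" by (rule zero) (use s in auto)
      then show "\<epsilon> ?W s * \<Psi> (insert s ?W) = 0" by simp
    qed
    then show ?thesis using W(3) by (subst sum.remove[of _ t]) simp_all
  qed
  with cocycle[OF W(1,2)] sign[OF W(1,3)] nz W(4) show False by simp
qed

lemma zero_if_not_gapless: "\<not> gapless T \<Longrightarrow> \<Psi> T = 0"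
  using support by blast

text \<open>Deleting \<open>h + 1\<close> leaves three consecutive missing points, and only
  \<open>h + 1\<close> itself repairs this: adding \<open>h\<close> leaves \<open>h + 1\<close> and
  \<open>h + 2\<close> missing, adding any other point leaves \<open>h\<close> and
  \<open>h + 1\<close> missing.\<close>

lemma zero_if_adjacent_holes:
  assumes "hole T h" "hole T (h + 2)" "h + 1 \<in> T"
  shows "\<Psi> T = 0"
proof (rule exchange[OF assms(3)])
  fix s assume s: "s \<notin> T"
  obtain x y where xy: "x \<in> T" "x < h" "y \<in> T" "h + 2 < y" using assms by (auto simp: hole_def)
  let ?T = "insert s (T - {h + 1})"
  have "h \<notin> T" "h + 2 \<notin> T" using assms by (auto simp: hole_def)
  have "s \<noteq> h + 1" using s assms by auto
  have "hole ?T (h + 1)"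
    by (rule holeI[of _ _ x y]) (use xy \<open>s \<noteq> h + 1\<close> in auto)
  moreover have "hole ?T h" if "s \<noteq> h"
    by (rule holeI[of _ _ x y]) (use xy that \<open>h \<notin> T\<close> in auto)
  ultimately have "\<not> gapless ?T"
    using not_gaplessI[of ?T h] not_gaplessI[of ?T "h + 1"] \<open>s \<noteq> h + 1\<close> \<open>h + 2 \<notin> T\<close>
    by (cases "s = h") auto
  then show "\<Psi> ?T = 0" by (rule zero_if_not_gapless)
qed

text \<open>Deleting \<open>h + 1\<close> makes \<open>h\<close> and \<open>h + 1\<close> both
  missing, so a gapless set arises only by restoring \<open>h + 1\<close> or by adding
  \<open>h\<close>. The latter moves the hole one place up, and vanishing there transfers back to
  \<open>T\<close>.\<close>

lemma zero_after_hole_move: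
  assumes "hole T h" "h + 1 \<in> T" "h + 2 \<in> T" "\<Psi> (insert h (T - {h + 1})) = 0"
  shows "\<Psi> T = 0"
proof (rule exchange[OF assms(2)])
  fix s assume s: "s \<notin> T"
  obtain x where xy: "x \<in> T" "x < h" "h \<notin> T" using assms by (auto simp: hole_def)
  let ?T = "insert s (T - {h + 1})"
  show "\<Psi> ?T = 0"
  proof (cases "s = h")
    case False
    have "s \<noteq> h + 1" using s assms by auto
    have "hole ?T h" by (rule holeI[of _ _ x "h + 2"]) (use xy assms False in auto)
    then have "\<not> gapless ?T" using \<open>s \<noteq> h + 1\<close> by (intro not_gaplessI[of ?T h]) auto
    then show ?thesis by (rule zero_if_not_gapless)
  qed (use assms in simp)
qed

text \<open>The lower hole is moved up until the next hole is two places above it, where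
  \<open>zero_if_adjacent_holes\<close> applies. Each move changes the set, so the induction on the
  distance is over all \<open>T\<close>.\<close>

lemma zero_if_two_holes:
  assumes "hole T h" "hole T h'" "h < h'"
  shows "\<Psi> T = 0"
  using assms
proof (induction "h' - h" arbitrary: T h rule: less_induct)
  case less
  show ?case
  proof (cases "gapless T")
    case True
    then have h1: "h + 1 \<in> T" using less.prems by (auto simp: gapless_def)
    obtain x y where xy: "x \<in> T" "x < h" "y \<in> T" "h' < y" "h' \<notin> T"
      using less.prems by (auto simp: hole_def)
    have h': "h + 2 \<le> h'" using less.prems(3) h1 xy by (cases "h' = h + 1") auto
    show ?thesis
    proof (cases "h + 2 \<in> T")
      case False
      have "hole T (h + 2)" by (rule holeI[of _ _ x y]) (use xy h' False in auto)
      then show ?thesis by (rule zero_if_adjacent_holes[OF less.prems(1) _ h1])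
    next
      case True
      let ?T = "insert h (T - {h + 1})"
      \<comment> \<open>Hence the moved hole \<open>h + 1\<close> still lies below
        \<open>h'\<close>, and the distance has dropped.\<close>
      have ne: "h' \<noteq> h + 2" using xy True by auto
      have "hole ?T (h + 1)" by (rule holeI[of _ _ x y]) (use xy h' in auto)
      moreover have "hole ?T h'" by (rule holeI[of _ _ x y]) (use xy h' in auto)
      ultimately have "\<Psi> ?T = 0" by (rule less.hyps[rotated]) (use h' ne in auto)
      then show ?thesis by (rule zero_after_hole_move[OF less.prems(1) h1 True])
    qed
  qed (rule zero_if_not_gapless)
qed

text \<open>The hole moves up within the interval until it reaches \<open>a + k - 1\<close>, the
  position normalised by \<open>base_hole\<close>.\<close>

lemma zero_if_interval_minus_point:
  assumes "1 \<le> a" "a < h" "h < a + k" "a + k < n"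
  shows "\<Psi> ({a..a + k} - {h}) = 0"
  using assms(2,3)
proof (induction "a + k - h" arbitrary: h rule: less_induct)
  case less
  show ?case
  proof (cases "h = a + k - 1")
    case True
    then show ?thesis using base_hole[OF assms(1,4)] by simp
  next
    case False
    then have h: "h + 2 \<le> a + k" using less.prems by linarith
    let ?T = "{a..a + k} - {h}"
    have "insert h (?T - {h + 1}) = {a..a + k} - {h + 1}" using less.prems by auto
    moreover have "\<Psi> ({a..a + k} - {h + 1}) = 0"
      by (rule less.hyps) (use h less.prems in linarith)+
    ultimately have zero: "\<Psi> (insert h (?T - {h + 1})) = 0" by simp
    have "hole ?T h" by (rule holeI[of _ _ a "a + k"]) (use less.prems in auto)
    moreover have "h + 1 \<in> ?T" "h + 2 \<in> ?T" using h less.prems by auto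
    ultimately show ?thesis by (rule zero_after_hole_move[OF _ _ _ zero])
  qed
qed

text \<open>If the value were nonzero, \<open>h\<close> would be the only hole, so \<open>T\<close>
  would be an interval of \<open>k + 1\<close> points minus \<open>h\<close>, ending before
  \<open>n\<close>.\<close>

lemma zero_if_hole:
  assumes "n \<notin> T" "hole T h"
  shows "\<Psi> T = 0"
proof (rule ccontr)
  assume nz: "\<Psi> T \<noteq> 0"
  from support[OF nz] have T: "T \<subseteq> {1..n}" "card T = k" "finite T" "T \<noteq> {}"
    using finite_subset k by (blast, blast, blast, force)
  have "{h'. hole T h'} = {h}"
    using zero_if_two_holes[of T h] zero_if_two_holes[of T _ h] nz assms(2)
    by (auto intro: linorder_cases)
  with eq_atLeastAtMost_diff_holes[OF T(3,4)] have eq: "T = {Min T..Max T} - {h}" by simp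
  have b: "1 \<le> Min T" "Max T < n" using Min_in[OF T(3,4)] Max_in[OF T(3,4)] T(1) assms(1)
    by (auto simp: le_less)
  have h: "Min T < h" "h < Max T"
    using assms(2) Min_le[OF T(3)] Max_ge[OF T(3)] by (auto simp: hole_def) (meson le_less_trans less_le_trans)+
  have "card T = card {Min T..Max T} - 1" using h by (subst eq) simp
  then have "Max T = Min T + k" using h T(2) k by simp
  then have "\<Psi> T = 0" using zero_if_interval_minus_point[of "Min T" h] b h eq by simp
  with nz show False ..
qed

text \<open>Only intervals of length \<open>k\<close> remain. The one ending in \<open>n - 1\<close>
  is normalised by \<open>base_interval\<close>; in any other, an interior point is exchanged so as
  to create a hole.\<close>

theorem zero_if_not_last:
  assumes "n \<notin> T"
  shows "\<Psi> T = 0"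
proof (rule ccontr)
  assume nz: "\<Psi> T \<noteq> 0"
  from support[OF nz] have T: "T \<subseteq> {1..n}" "card T = k" "finite T" "T \<noteq> {}"
    using finite_subset k by (blast, blast, blast, force)
  define a where "a = Min T"
  have "{h. hole T h} = {}" using zero_if_hole[OF assms] nz by auto
  with eq_atLeastAtMost_diff_holes[OF T(3,4)] have eq: "T = {a..Max T}" by (simp add: a_def)
  have b: "1 \<le> a" "Max T < n" using Min_in[OF T(3,4)] Max_in[OF T(3,4)] T(1) assms(1)
    by (auto simp: le_less a_def)
  have "card T = Suc (Max T) - a" by (subst eq) simp
  then have m: "Suc (Max T) = a + k" using T(2) k by simp
  have eq': "T = {a..<a + k}" by (subst eq) (simp add: m[symmetric] atLeastLessThanSuc_atLeastAtMost)
  show False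
  proof (cases "a + k = n")
    case True
    then have "T = {n - k..<n}" using eq' by auto
    then show False using base_interval nz by simp
  next
    case False
    then have n: "a + k < n" using b m by simp
    \<comment> \<open>As \<open>k \<ge> 3\<close>, the point \<open>a + 1\<close> is interior: once
      it is deleted, \<open>a\<close> and \<open>a + 2\<close> remain and make it a hole.\<close>
    have "\<Psi> T = 0"
    proof (rule exchange[of "a + 1"])
      show "a + 1 \<in> T" using k by (simp add: eq')
      fix s assume s: "s \<notin> T"
      let ?T = "insert s (T - {a + 1})"
      have h: "hole ?T (a + 1)"
      proof (rule holeI[of _ _ a "a + 2"])
        show "a + 1 \<notin> ?T" using s k by (auto simp: eq')
        show "a \<in> ?T" "a + 2 \<in> ?T" using k by (simp_all add: eq')
      qed simp_all
      show "\<Psi> ?T = 0"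
      proof (cases "s = n")
        case False
        then have "n \<notin> ?T" using assms by simp
        then show ?thesis using h by (rule zero_if_hole)
      next
        case True
        \<comment> \<open>Adding \<open>n\<close> is the one replacement that
          \<open>zero_if_hole\<close> does not cover, but it turns \<open>a + k\<close> into a
          second hole because \<open>a + k < n\<close>.\<close>
        have "hole ?T (a + k)"
        proof (rule holeI[of _ _ a n])
          have "a + k \<notin> T" unfolding eq' by simp
          moreover have "a + k \<noteq> s" using n True by simp
          ultimately show "a + k \<notin> ?T" by simp
          show "a \<in> ?T" "n \<in> ?T" using True k by (simp_all add: eq')
        qed (use n k in simp_all)
        moreover have "a + 1 < a + k" using k by simp
        ultimately show ?thesis by (rule zero_if_two_holes[OF h])
      qed
    qed
    with nz show False ..
  qed
qed

end

section \<open>Connected subsets of the squared path\<close>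

text \<open>Arcs advance by at most 2, so two consecutive missing points cannot be crossed;
  conversely, steps of 1 or 2 lead from any element up to any larger one. The empty set is gapless
  but not connected, whence the second assumption.\<close>

lemma connected_squared_path_iff_gapless:
  assumes "T \<subseteq> {1..n}" "T \<noteq> {}"
  shows "connected (with_proj (squared_path n) \<restriction> T) \<longleftrightarrow> gapless T"
proof -
  define H where "H = mk_symmetric (with_proj (squared_path n) \<restriction> T)"
  have verts: "verts (with_proj H) = T" by (simp add: H_def)
  have arcs: "(i, j) \<in> arcs_ends (with_proj H) \<longleftrightarrow>
      i \<in> T \<and> j \<in> T \<and> (j = i + 1 \<or> j = i + 2 \<or> i = j + 1 \<or> i = j + 2)" (is "?l \<longleftrightarrow> ?r") for i j
  proof
    show "?l \<Longrightarrow> ?r" by (auto simp: H_def parcs_mk_symmetric squared_path_def)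
  next
    assume r: ?r
    then have "i \<in> {1..n}" "j \<in> {1..n}" using assms(1) by blast+
    with r have "(i, j) \<in> arcs (with_proj (squared_path n) \<restriction> T)"
      by (simp add: squared_path_def)
    then show ?l by (simp only: H_def with_proj_simps parcs_mk_symmetric) (rule UN_I[of "(i, j)"], simp_all)
  qed
  have conn: "connected (with_proj (squared_path n) \<restriction> T) \<longleftrightarrow> (\<forall>u\<in>T. \<forall>v\<in>T. u \<rightarrow>\<^sup>*\<^bsub>with_proj H\<^esub> v)"
    using assms(2) unfolding connected_def strongly_connected_def H_def[symmetric] verts by simp
  show ?thesis
  proof
    assume c: "connected (with_proj (squared_path n) \<restriction> T)"
    show "gapless T" unfolding gapless_alt
    proof (intro ballI impI, rule ccontr)
      fix x assume x: "x \<in> T" "\<exists>y\<in>T. x < y" "\<not> (x + 1 \<in> T \<or> x + 2 \<in> T)"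
      then obtain y where y: "y \<in> T" "x < y" by blast
      have "(x, y) \<in> rtrancl_on T (arcs_ends (with_proj H))"
        using c x(1) y(1) unfolding conn reachable_def verts by blast
      \<comment> \<open>Invariant along the walk: from a vertex at or below \<open>x\<close>, an arc
        could pass \<open>x\<close> only by landing on \<open>x + 1\<close> or
        \<open>x + 2\<close>.\<close>
      then have "y \<le> x"
      proof (induction rule: rtrancl_on_induct)
        case (step b c)
        then have "c \<in> T" "c \<le> b + 2" unfolding arcs by auto
        moreover from this have "c \<noteq> x + 1" "c \<noteq> x + 2" using x(3) by metis+
        ultimately show ?case using step by linarith
      qed simp
      with y show False by simp
    qed
  next
    assume g: "gapless T"
    have up: "u \<rightarrow>\<^sup>*\<^bsub>with_proj H\<^esub> v" if "u \<in> T" "v \<in> T" "u \<le> v" for u v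
      using that
    proof (induction "v - u" arbitrary: u rule: less_induct)
      case less
      show ?case
      proof (cases "u = v")
        case True
        then show ?thesis using less.prems unfolding reachable_def verts by (simp add: rtrancl_on.intros)
      next
        case False
        then have "u < v" using less.prems by simp
        then have "\<exists>w\<in>T. u < w \<and> w \<le> v \<and> w \<le> u + 2"
        proof (cases "u + 1 \<in> T")
          case True
          then show ?thesis using \<open>u < v\<close> by (intro bexI[of _ "u + 1"]) auto
        next
          case False
          then have "v \<noteq> u + 1" using less.prems by auto
          moreover have "u + 2 \<in> T"
            using g False less.prems(1,2) \<open>u < v\<close> unfolding gapless_alt by blast
          ultimately show ?thesis using \<open>u < v\<close> by (intro bexI[of _ "u + 2"]) auto
        qed
        then obtain w where w: "w \<in> T" "u < w" "w \<le> v" "w \<le> u + 2" by blast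
        then have "(u, w) \<in> arcs_ends (with_proj H)" using less.prems unfolding arcs by auto
        moreover have "w \<rightarrow>\<^sup>*\<^bsub>with_proj H\<^esub> v" using w less.prems by (intro less.hyps) auto
        ultimately show ?thesis using less.prems unfolding reachable_def verts
          by (blast intro: converse_rtrancl_on_into_rtrancl_on)
      qed
    qed
    have sym: "symmetric (with_proj H)" unfolding H_def by (rule symmetric_mk_symmetric)
    show "connected (with_proj (squared_path n) \<restriction> T)" unfolding conn
    proof (intro ballI)
      fix u v assume "u \<in> T" "v \<in> T"
      then show "u \<rightarrow>\<^sup>*\<^bsub>with_proj H\<^esub> v"
        using up[of u v] up[of v u] symmetric_reachable[OF sym]
        by (cases "u \<le> v") auto
    qed
  qed
qed

section \<open>Boundary and coboundary of a simplex\<close>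

text \<open>The count is strict, so the sign is the same for \<open>\<sigma>\<close> and
  \<open>\<sigma> - {v}\<close>; this allows it to be indexed by the smaller face.\<close>

definition face_sign :: "'a::linorder set \<Rightarrow> 'a \<Rightarrow> 'k::field" where
  "face_sign \<sigma> v = (-1) ^ card {w \<in> \<sigma>. w < v}"

lemma face_sign_nonzero: "face_sign \<sigma> v \<noteq> (0::'k::field)"
  by (simp add: face_sign_def)

lemma face_sign_insert:
  assumes "finite \<sigma>" "x \<notin> \<sigma>"
  shows "face_sign (insert x \<sigma>) v = (if x < v then - face_sign \<sigma> v else (face_sign \<sigma> v :: 'k::field))"
proof -
  have "{w \<in> insert x \<sigma>. w < v} = (if x < v then insert x {w \<in> \<sigma>. w < v} else {w \<in> \<sigma>. w < v})"
    by auto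
  then show ?thesis using assms by (simp add: face_sign_def)
qed

text \<open>Exactly one of \<open>u\<close>, \<open>v\<close> is smaller, so exactly one of the two
  insertions flips a sign.\<close>

lemma face_sign_anticommute:
  assumes "finite \<sigma>" "u \<notin> \<sigma>" "v \<notin> \<sigma>" "u \<noteq> v"
  shows "face_sign (insert u \<sigma>) v * face_sign \<sigma> u = - (face_sign (insert v \<sigma>) u * face_sign \<sigma> v :: 'k::field)"
  using assms by (cases u v rule: linorder_cases) (simp_all add: face_sign_insert mult.commute)

lemma sum_antisymmetric:
  fixes g :: "'a::linorder \<Rightarrow> 'a \<Rightarrow> 'k::ab_group_add"
  assumes "finite A" and anti: "\<And>u v. u \<in> A \<Longrightarrow> v \<in> A \<Longrightarrow> u \<noteq> v \<Longrightarrow> g u v = - g v u"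
  shows "(\<Sum>u\<in>A. \<Sum>v\<in>A - {u}. g u v) = 0"
proof -
  (* The sum is not just its own negative: in characteristic 2 the pairs must be cancelled. *)
  have "(\<Sum>v\<in>A - {u}. g u v) = (\<Sum>v\<in>A. if u < v then g u v else 0) + (\<Sum>v\<in>A. if v < u then g u v else 0)"
    if "u \<in> A" for u
  proof -
    have "(\<Sum>v\<in>A - {u}. g u v) = (\<Sum>v\<in>A - {u}. (if u < v then g u v else 0) + (if v < u then g u v else 0))"
      by (rule sum.cong) auto
    also have "\<dots> = (\<Sum>v\<in>A. (if u < v then g u v else 0) + (if v < u then g u v else 0))"
      using assms(1) by (intro sum.mono_neutral_left) auto
    finally show ?thesis by (simp only: sum.distrib)
  qed
  then have "(\<Sum>u\<in>A. \<Sum>v\<in>A - {u}. g u v) = (\<Sum>u\<in>A. \<Sum>v\<in>A. if u < v then g u v else 0)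
      + (\<Sum>u\<in>A. \<Sum>v\<in>A. if v < u then g u v else 0)"
    by (simp only: sum.distrib cong: sum.cong)
  also have "(\<Sum>u\<in>A. \<Sum>v\<in>A. if v < u then g u v else 0) = (\<Sum>v\<in>A. \<Sum>u\<in>A. if v < u then g u v else 0)"
    by (rule sum.swap)
  also have "\<dots> = (\<Sum>v\<in>A. \<Sum>u\<in>A. - (if v < u then g v u else 0))"
  proof (rule sum.cong[OF refl], rule sum.cong[OF refl])
    fix u v assume "u \<in> A" "v \<in> A"
    then show "(if v < u then g u v else 0) = - (if v < u then g v u else 0)"
      using anti[of u v] by (cases "v < u") simp_all
  qed
  finally show ?thesis by (simp add: sum_negf)
qed

text \<open>The boundary in the full simplex on \<open>V\<close>, given by its coefficient at
  \<open>\<tau>\<close> as a sum over cofaces. No complex enters, so the square-zero identity holds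
  at every subset of \<open>V\<close>.\<close>

definition simplex_boundary :: "'a::linorder set \<Rightarrow> ('a set \<Rightarrow> 'k::field) \<Rightarrow> 'a set \<Rightarrow> 'k" where
  "simplex_boundary V c \<tau> = (\<Sum>v\<in>V - \<tau>. face_sign \<tau> v * c (insert v \<tau>))"

definition simplex_coboundary :: "('a::linorder set \<Rightarrow> 'k::field) \<Rightarrow> 'a set \<Rightarrow> 'k" where
  "simplex_coboundary \<phi> \<sigma> = (\<Sum>v\<in>\<sigma>. face_sign (\<sigma> - {v}) v * \<phi> (\<sigma> - {v}))"

text \<open>A chain of \<open>K\<close> vanishes on the cofaces outside \<open>K\<close>, so these
  may be added to the sum.\<close>

lemma boundary_map_eq_simplex_boundary:
  fixes c :: "'a::linorder set \<Rightarrow> 'k::field"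
  assumes V: "finite V" and K: "K \<subseteq> Pow V" and c: "\<And>\<sigma>. c \<sigma> \<noteq> 0 \<Longrightarrow> \<sigma> \<in> K"
  shows "boundary_map K c = simplex_boundary V c"
proof (rule ext)
  fix \<tau> :: "'a set"
  have finK: "finite K" using V K by (meson finite_Pow_iff finite_subset)
  have sgn: "(-1) ^ card {w \<in> insert v \<tau>. w < v} = (face_sign \<tau> v :: 'k)" for v
  proof -
    have "{w \<in> insert v \<tau>. w < v} = {w \<in> \<tau>. w < v}" by auto
    then show ?thesis by (simp add: face_sign_def)
  qed
  have "boundary_map K c \<tau> =
      (\<Sum>\<sigma>\<in>K. \<Sum>v\<in>V. if v \<notin> \<tau> \<and> \<sigma> = insert v \<tau> then face_sign \<tau> v * c (insert v \<tau>) else 0)"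
    unfolding boundary_map_def
  proof (rule sum.cong[OF refl])
    fix \<sigma> assume "\<sigma> \<in> K"
    then have \<sigma>: "\<sigma> \<subseteq> V" using K by auto
    have "(\<Sum>v\<in>\<sigma>. if \<tau> = \<sigma> - {v} then (-1) ^ card {w \<in> \<sigma>. w < v} * c \<sigma> else 0) =
        (\<Sum>v\<in>\<sigma>. if v \<notin> \<tau> \<and> \<sigma> = insert v \<tau> then face_sign \<tau> v * c (insert v \<tau>) else 0)"
    proof (rule sum.cong[OF refl])
      fix v assume "v \<in> \<sigma>"
      then have "\<tau> = \<sigma> - {v} \<longleftrightarrow> v \<notin> \<tau> \<and> \<sigma> = insert v \<tau>" by auto
      then show "(if \<tau> = \<sigma> - {v} then (-1) ^ card {w \<in> \<sigma>. w < v} * c \<sigma> else 0) =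
          (if v \<notin> \<tau> \<and> \<sigma> = insert v \<tau> then face_sign \<tau> v * c (insert v \<tau>) else 0)"
        using sgn[of v] by simp
    qed
    also have "\<dots> = (\<Sum>v\<in>V. if v \<notin> \<tau> \<and> \<sigma> = insert v \<tau> then face_sign \<tau> v * c (insert v \<tau>) else 0)"
      using V \<sigma> by (intro sum.mono_neutral_left) auto
    finally show "(\<Sum>v\<in>\<sigma>. if \<tau> = \<sigma> - {v} then (-1) ^ card {w \<in> \<sigma>. w < v} * c \<sigma> else 0) =
        (\<Sum>v\<in>V. if v \<notin> \<tau> \<and> \<sigma> = insert v \<tau> then face_sign \<tau> v * c (insert v \<tau>) else 0)" .
  qed
  also have "\<dots> = (\<Sum>v\<in>V. \<Sum>\<sigma>\<in>K. if v \<notin> \<tau> \<and> \<sigma> = insert v \<tau> then face_sign \<tau> v * c (insert v \<tau>) else 0)"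
    by (rule sum.swap)
  also have "\<dots> = (\<Sum>v\<in>V. if v \<notin> \<tau> then face_sign \<tau> v * c (insert v \<tau>) else 0)"
  proof (rule sum.cong[OF refl])
    fix v
    show "(\<Sum>\<sigma>\<in>K. if v \<notin> \<tau> \<and> \<sigma> = insert v \<tau> then face_sign \<tau> v * c (insert v \<tau>) else 0) =
        (if v \<notin> \<tau> then face_sign \<tau> v * c (insert v \<tau>) else 0)"
      using finK c[of "insert v \<tau>"] by (cases "v \<in> \<tau>") (auto simp: sum.delta)
  qed
  also have "\<dots> = simplex_boundary V c \<tau>"
    unfolding simplex_boundary_def using V by (intro sum.mono_neutral_cong_right) auto
  finally show "boundary_map K c \<tau> = simplex_boundary V c \<tau>" .
qed

text \<open>Two vertices can be added in either order, and the two contributions cancel by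
  \<open>face_sign_anticommute\<close>.\<close>

lemma simplex_boundary_boundary:
  fixes c :: "'a::linorder set \<Rightarrow> 'k::field"
  assumes "finite V" "\<rho> \<subseteq> V"
  shows "simplex_boundary V (simplex_boundary V c) \<rho> = 0"
proof -
  have fin: "finite \<rho>" "finite (V - \<rho>)" using assms finite_subset by auto
  let ?g = "\<lambda>u v. face_sign \<rho> u * (face_sign (insert u \<rho>) v * c (insert v (insert u \<rho>)))"
  have "simplex_boundary V (simplex_boundary V c) \<rho> = (\<Sum>u\<in>V - \<rho>. \<Sum>v\<in>V - \<rho> - {u}. ?g u v)"
    unfolding simplex_boundary_def sum_distrib_left by (simp only: Diff_insert[of V _ \<rho>])
  also have "\<dots> = 0"
  proof (rule sum_antisymmetric[OF fin(2)])
    fix u v assume uv: "u \<in> V - \<rho>" "v \<in> V - \<rho>" "u \<noteq> v"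
    have "?g u v = (face_sign (insert u \<rho>) v * face_sign \<rho> u) * c (insert v (insert u \<rho>))"
      by (simp add: mult_ac)
    also have "\<dots> = - (face_sign (insert v \<rho>) u * face_sign \<rho> v) * c (insert u (insert v \<rho>))"
      using face_sign_anticommute[of \<rho> u v, where 'k='k] uv fin(1) by (simp add: insert_commute)
    also have "\<dots> = - ?g v u" by (simp add: mult_ac)
    finally show "?g u v = - ?g v u" .
  qed
  finally show ?thesis .
qed

lemma simplex_coboundary_coboundary:
  fixes \<phi> :: "'a::linorder set \<Rightarrow> 'k::field"
  assumes "finite \<sigma>"
  shows "simplex_coboundary (simplex_coboundary \<phi>) \<sigma> = 0"
proof -
  let ?g = "\<lambda>u v. face_sign (\<sigma> - {u}) u * (face_sign (\<sigma> - {u} - {v}) v * \<phi> (\<sigma> - {u} - {v}))"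
  have "simplex_coboundary (simplex_coboundary \<phi>) \<sigma> = (\<Sum>u\<in>\<sigma>. \<Sum>v\<in>\<sigma> - {u}. ?g u v)"
    unfolding simplex_coboundary_def sum_distrib_left ..
  also have "\<dots> = 0"
  proof (rule sum_antisymmetric[OF assms])
    fix u v assume uv: "u \<in> \<sigma>" "v \<in> \<sigma>" "u \<noteq> v"
    define \<rho> where "\<rho> = \<sigma> - {u} - {v}"
    have \<rho>: "finite \<rho>" "u \<notin> \<rho>" "v \<notin> \<rho>" "\<sigma> - {u} = insert v \<rho>" "\<sigma> - {v} = insert u \<rho>"
      "\<sigma> - {v} - {u} = \<rho>"
      using uv assms by (auto simp: \<rho>_def)
    have "?g u v = (face_sign (insert v \<rho>) u * face_sign \<rho> v) * \<phi> \<rho>"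
      unfolding \<rho>_def[symmetric] unfolding \<rho>(4) by (simp add: mult_ac)
    also have "\<dots> = - (face_sign (insert u \<rho>) v * face_sign \<rho> u) * \<phi> \<rho>"
      using uv by (simp only: face_sign_anticommute[OF \<rho>(1,3,2), where 'k='k] not_sym)
    also have "\<dots> = - ?g v u" unfolding \<rho>(6) unfolding \<rho>(5) by (simp add: mult_ac)
    finally show "?g u v = - ?g v u" .
  qed
  finally show ?thesis .
qed

section \<open>Top cycles\<close>

text \<open>The square-zero identity at \<open>\<rho>\<close> is a relation between the boundary
  coefficients at its cofaces. This is how the equations left out of the system are
  recovered.\<close>

lemma simplex_boundary_exchange:
  assumes "finite V" "\<rho> \<subseteq> V" "v \<in> V - \<rho>"
    and zero: "\<And>u. u \<in> V - \<rho> \<Longrightarrow> u \<noteq> v \<Longrightarrow> simplex_boundary V c (insert u \<rho>) = (0::'k::field)"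
  shows "simplex_boundary V c (insert v \<rho>) = 0"
proof -
  let ?e = "simplex_boundary V c"
  have "(\<Sum>u\<in>V - \<rho>. face_sign \<rho> u * ?e (insert u \<rho>)) = 0"
    using simplex_boundary_boundary[OF assms(1,2), of c] unfolding simplex_boundary_def[of V ?e] .
  moreover have "(\<Sum>u\<in>V - \<rho>. face_sign \<rho> u * ?e (insert u \<rho>)) = face_sign \<rho> v * ?e (insert v \<rho>)"
  proof -
    have "(\<Sum>u\<in>V - \<rho> - {v}. face_sign \<rho> u * ?e (insert u \<rho>)) = 0"
      by (rule sum.neutral) (simp add: zero)
    then show ?thesis using assms(1,3) by (subst sum.remove[of _ v]) simp_all
  qed
  ultimately show ?thesis using face_sign_nonzero[of \<rho> v, where 'k='k] by simp
qed

section \<open>The incidence matrix and its rows\<close>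

definition facet_sets :: "nat \<Rightarrow> nat \<Rightarrow> nat set set" where
  "facet_sets n r = {F. F \<subseteq> {1..n} \<and> card F = r \<and> \<not> gapless ({1..n} - F)}"

lemma finite_facet_sets: "finite (facet_sets n r)"
  by (rule finite_subset[of _ "Pow {1..n}"]) (auto simp: facet_sets_def)

text \<open>The matrix of the boundary map; at most one summand is nonzero. Rows
  \<open>\<tau>\<close> are equations, columns \<open>F\<close> are unknowns.\<close>

definition incidence :: "nat set \<Rightarrow> nat set \<Rightarrow> 'k::field" where
  "incidence \<tau> F = (\<Sum>v\<in>F. if \<tau> = F - {v} then face_sign \<tau> v else 0)"

lemma sum_incidence_mult_chain:
  fixes f :: "nat set \<Rightarrow> 'k::field"
  assumes "finite V" "U \<subseteq> Pow V" "\<And>F. F \<notin> U \<Longrightarrow> f F = 0"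
  shows "(\<Sum>F\<in>U. incidence \<tau> F * f F) = simplex_boundary V f \<tau>"
proof -
  have "(\<Sum>F\<in>U. incidence \<tau> F * f F) = boundary_map U f \<tau>"
    unfolding incidence_def boundary_map_def sum_distrib_right
  proof (rule sum.cong[OF refl], rule sum.cong[OF refl])
    fix F :: "nat set" and v :: nat
    have "{w \<in> F - {v}. w < v} = {w \<in> F. w < v}" by auto
    then show "(if \<tau> = F - {v} then face_sign \<tau> v else 0) * f F =
        (if \<tau> = F - {v} then (- 1) ^ card {w \<in> F. w < v} * f F else 0)"
      by (simp add: face_sign_def)
  qed
  also have "boundary_map U f = simplex_boundary V f"
    by (rule boundary_map_eq_simplex_boundary[OF assms(1,2)]) (use assms(3) in blast)
  finally show ?thesis .
qed

text \<open>A combination of rows is the coboundary of its coefficients extended by zero, so linear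
  relations between equations become statements about cochains.\<close>

lemma sum_cochain_mult_incidence:
  fixes \<phi> :: "nat set \<Rightarrow> 'k::field"
  assumes "finite C"
  shows "(\<Sum>\<tau>\<in>C. \<phi> \<tau> * incidence \<tau> F) = simplex_coboundary (\<lambda>\<tau>. if \<tau> \<in> C then \<phi> \<tau> else 0) F"
proof -
  have "(\<Sum>\<tau>\<in>C. \<phi> \<tau> * incidence \<tau> F) = (\<Sum>v\<in>F. \<Sum>\<tau>\<in>C. \<phi> \<tau> * (if \<tau> = F - {v} then face_sign \<tau> v else 0))"
    unfolding incidence_def sum_distrib_left by (rule sum.swap)
  also have "\<dots> = simplex_coboundary (\<lambda>\<tau>. if \<tau> \<in> C then \<phi> \<tau> else 0) F"
    unfolding simplex_coboundary_def
  proof (rule sum.cong[OF refl])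
    fix v :: nat
    have "(\<Sum>\<tau>\<in>C. \<phi> \<tau> * (if \<tau> = F - {v} then face_sign \<tau> v else 0)) =
        (\<Sum>\<tau>\<in>C. if \<tau> = F - {v} then face_sign (F - {v}) v * \<phi> (F - {v}) else 0)"
      by (rule sum.cong) simp_all
    also have "\<dots> = face_sign (F - {v}) v * (if F - {v} \<in> C then \<phi> (F - {v}) else 0)"
      using assms by (simp add: sum.delta)
    finally show "(\<Sum>\<tau>\<in>C. \<phi> \<tau> * (if \<tau> = F - {v} then face_sign \<tau> v else 0)) =
        face_sign (F - {v}) v * (if F - {v} \<in> C then \<phi> (F - {v}) else 0)" .
  qed
  finally show ?thesis .
qed

lemma gapless_interval_minus_point: "gapless ({a..b} - {v})"
  unfolding gapless_def
proof (intro allI impI)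
  fix h assume "hole ({a..b} - {v}) h"
  then show "Suc h \<in> {a..b} - {v}" by (auto simp: hole_def)
qed

text \<open>Complements, within \<open>{1..<k + r}\<close>, of the ridges whose equations are redundant: one for each
  interval of length \<open>k + 1\<close> in \<open>{1..k + r}\<close>. For the interval ending in \<open>k + r\<close>, the ridge is the
  complement of that interval itself.\<close>

definition dependent_complements :: "nat \<Rightarrow> nat \<Rightarrow> nat set set" where
  "dependent_complements k r = insert {r..<k + r} ((\<lambda>a. {a..a + k} - {a + k - 1}) ` {1..<r})"

text \<open>Inside \<open>{1..<k + r}\<close>, the complement of a \<open>k\<close>-set has
  \<open>r - 1\<close> elements, so removing these complements removes ridges.\<close>

definition independent_ridges :: "nat \<Rightarrow> nat \<Rightarrow> nat set set" where
  "independent_ridges k r = {\<tau>. \<tau> \<subseteq> {1..<k + r} \<and> card \<tau> = r - 1}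
      - (\<lambda>T. {1..<k + r} - T) ` dependent_complements k r"

text \<open>The removed ridges are \<open>r\<close> in number because the sets in
  \<open>dependent_complements\<close> have distinct least elements: \<open>r\<close> for the
  interval, \<open>a < r\<close> for the others.\<close>

lemma card_independent_ridges:
  assumes "k \<ge> 3" "r \<ge> 1"
  shows "card (independent_ridges k r) + r = (k + r - 1) choose (r - 1)"
proof -
  let ?M = "{1..<k + r}" and ?h = "\<lambda>a. {a..a + k} - {a + k - 1}"
  let ?full = "{\<tau>. \<tau> \<subseteq> ?M \<and> card \<tau> = r - 1}"
  have sub: "T \<subseteq> ?M \<and> card T = k" if "T \<in> dependent_complements k r" for T
    using that assms by (auto simp: dependent_complements_def)
  have "inj_on ?h {1..<r}"
  proof (rule inj_onI)
    fix a b assume "?h a = ?h b"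
    moreover have "a \<in> ?h a" "b \<in> ?h b" using assms by auto
    ultimately have "a \<in> ?h b" "b \<in> ?h a" by blast+
    then show "a = b" by simp
  qed
  moreover have "{r..<k + r} \<notin> ?h ` {1..<r}"
  proof
    assume "{r..<k + r} \<in> ?h ` {1..<r}"
    then obtain a where a: "a \<in> {1..<r}" and eq: "{r..<k + r} = ?h a" by blast
    have "a \<in> ?h a" using assms by auto
    then have "a \<in> {r..<k + r}" unfolding eq .
    with a show False by simp
  qed
  ultimately have "card (dependent_complements k r) = r"
    using assms by (simp add: dependent_complements_def card_image)
  moreover have "inj_on (\<lambda>T. ?M - T) (dependent_complements k r)"
    using sub by (intro inj_onI) blast
  ultimately have card_drop: "card ((\<lambda>T. ?M - T) ` dependent_complements k r) = r"
    by (simp add: card_image)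
  have "(\<lambda>T. ?M - T) ` dependent_complements k r \<subseteq> ?full"
    using sub by (auto simp: card_Diff_subset finite_subset[of _ ?M])
  moreover have "finite ?full" by (rule finite_subset[of _ "Pow ?M"]) auto
  moreover have "card ?full = (k + r - 1) choose (r - 1)"
    using n_subsets[of ?M "r - 1"] by simp
  ultimately show ?thesis
    using card_drop card_Diff_subset[of "(\<lambda>T. ?M - T) ` dependent_complements k r" ?full]
      card_mono[of ?full "(\<lambda>T. ?M - T) ` dependent_complements k r"]
    unfolding independent_ridges_def by (simp add: finite_subset)
qed

text \<open>For a relation \<open>\<phi>\<close>, the coboundary of its extension by zero vanishes
  on facets, so on complements it is supported on gapless sets and \<open>gapless_cocycle\<close>
  applies. By \<open>zero_if_not_last\<close> it vanishes on sets avoiding \<open>k + r\<close>,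
  where its values are those of \<open>\<phi>\<close> up to sign.\<close>

lemma independent_ridges_independent:
  fixes \<phi> :: "nat set \<Rightarrow> 'k::field"
  assumes k: "k \<ge> 3" and r: "r \<ge> 1"
    and zero: "\<And>F. F \<in> facet_sets (k + r) r \<Longrightarrow>
      (\<Sum>\<tau>\<in>independent_ridges k r. \<phi> \<tau> * incidence \<tau> F) = 0"
  shows "\<forall>\<tau>\<in>independent_ridges k r. \<phi> \<tau> = 0"
proof -
  let ?N = "{1..k + r}" and ?M = "{1..<k + r}" and ?n = "k + r"
  let ?C = "independent_ridges k r"
  have finC: "finite ?C"
    by (rule finite_subset[of _ "Pow ?M"]) (auto simp: independent_ridges_def)
  define \<phi>' where "\<phi>' = (\<lambda>\<tau>. if \<tau> \<in> ?C then \<phi> \<tau> else 0)"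
  define \<psi> where "\<psi> = simplex_coboundary \<phi>'"
  define \<Psi> where "\<Psi> = (\<lambda>T. if T \<subseteq> ?N \<and> card T = k then \<psi> (?N - T) else 0)"
  have \<psi>_zero: "\<psi> F = 0" if "F \<in> facet_sets ?n r" for F
    using zero[OF that] sum_cochain_mult_incidence[OF finC, of \<phi> F] by (simp add: \<psi>_def \<phi>'_def)
  \<comment> \<open>The cochain lives on sets avoiding \<open>?n\<close>, while
    \<open>?N - T\<close> contains \<open>?n\<close>; only the term deleting \<open>?n\<close> can
    be nonzero.\<close>
  have \<psi>_cone: "\<psi> (?N - T) = face_sign (?M - T) ?n * \<phi>' (?M - T)" if T: "T \<subseteq> ?M" for T
  proof -
    have n: "?n \<in> ?N - T" "(?N - T) - {?n} = ?M - T" using T r by auto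
    have "(\<Sum>v\<in>?N - T - {?n}. face_sign (?N - T - {v}) v * \<phi>' (?N - T - {v})) = 0"
    proof (rule sum.neutral, rule ballI)
      fix v assume v: "v \<in> ?N - T - {?n}"
      have "\<tau> \<subseteq> ?M" if "\<tau> \<in> ?C" for \<tau> using that by (simp add: independent_ridges_def)
      moreover have "?n \<in> ?N - T - {v}" using v n(1) by blast
      ultimately have "?N - T - {v} \<notin> ?C" by fastforce
      then show "face_sign (?N - T - {v}) v * \<phi>' (?N - T - {v}) = 0" by (simp add: \<phi>'_def)
    qed
    then show ?thesis unfolding \<psi>_def simplex_coboundary_def
      using n by (subst sum.remove[of _ ?n]) simp_all
  qed
  have \<Psi>_eq: "\<Psi> T = face_sign (?M - T) ?n * \<phi>' (?M - T)" if "T \<subseteq> ?M" "card T = k" for T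
  proof -
    have "T \<subseteq> ?N" using that(1) by auto
    then show ?thesis using that \<psi>_cone[OF that(1)] by (simp add: \<Psi>_def)
  qed
  have \<Psi>_drop: "\<Psi> T = 0" if "T \<in> dependent_complements k r" "T \<subseteq> ?M" "card T = k" for T
  proof -
    have "?M - T \<notin> ?C" using that(1) by (simp add: independent_ridges_def)
    then show ?thesis using \<Psi>_eq[OF that(2,3)] by (simp add: \<phi>'_def)
  qed
  \<comment> \<open>Inserting \<open>s\<close> into \<open>W\<close> deletes it from the complement,
    so the cocycle relation is the square-zero identity for coboundaries at
    \<open>?N - W\<close>.\<close>
  interpret gapless_cocycle ?n k "\<lambda>W s. face_sign (?N - W - {s}) s" \<Psi>
  proof
    show "k \<ge> 3" by (rule k)
    show "face_sign (?N - W - {s}) s \<noteq> (0::'k)" for W s by (rule face_sign_nonzero)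
    show "T \<subseteq> ?N \<and> card T = k \<and> gapless T" if nz: "\<Psi> T \<noteq> 0" for T
    proof -
      have T: "T \<subseteq> ?N" "card T = k" "\<psi> (?N - T) \<noteq> 0" using nz by (auto simp: \<Psi>_def split: if_splits)
      then have "?N - T \<notin> facet_sets ?n r" using \<psi>_zero by blast
      moreover have "card (?N - T) = r" using T by (simp add: card_Diff_subset finite_subset[of _ ?N])
      moreover have "?N - (?N - T) = T" using T by blast
      ultimately have "gapless T" by (simp add: facet_sets_def)
      with T show ?thesis by blast
    qed
    show "(\<Sum>s\<in>?N - W. face_sign (?N - W - {s}) s * \<Psi> (insert s W)) = 0"
      if W: "W \<subseteq> ?N" "Suc (card W) = k" for W
    proof -
      have "\<Psi> (insert s W) = \<psi> (?N - W - {s})" if s: "s \<in> ?N - W" for s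
      proof -
        have "insert s W \<subseteq> ?N" "card (insert s W) = k"
          using W s finite_subset[of W ?N] by auto
        moreover have "?N - insert s W = ?N - W - {s}" by blast
        ultimately show ?thesis by (simp add: \<Psi>_def)
      qed
      then have "(\<Sum>s\<in>?N - W. face_sign (?N - W - {s}) s * \<Psi> (insert s W)) = simplex_coboundary \<psi> (?N - W)"
        unfolding simplex_coboundary_def by (intro sum.cong) simp_all
      also have "\<dots> = 0" unfolding \<psi>_def by (rule simplex_coboundary_coboundary) simp
      finally show ?thesis .
    qed
    show "\<Psi> ({a..a + k} - {a + k - 1}) = 0" if a: "1 \<le> a" "a + k < ?n" for a
    proof (rule \<Psi>_drop)
      have "a \<in> {1..<r}" using a by simp
      then show "{a..a + k} - {a + k - 1} \<in> dependent_complements k r"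
        unfolding dependent_complements_def by blast
      show "{a..a + k} - {a + k - 1} \<subseteq> ?M" using a by auto
      show "card ({a..a + k} - {a + k - 1}) = k" using k by simp
    qed
    show "\<Psi> {?n - k..<?n} = 0"
      by (rule \<Psi>_drop) (use r in \<open>auto simp: dependent_complements_def\<close>)
  qed
  show ?thesis
  proof
    fix \<tau> assume \<tau>: "\<tau> \<in> ?C"
    then have "\<tau> \<subseteq> ?M" "card \<tau> = r - 1" by (auto simp: independent_ridges_def)
    then have T: "?M - \<tau> \<subseteq> ?M" "card (?M - \<tau>) = k" "?M - (?M - \<tau>) = \<tau>"
      using r by (auto simp: card_Diff_subset finite_subset[of _ ?M])
    have "\<Psi> (?M - \<tau>) = 0" by (rule zero_if_not_last) simp
    then have "\<phi>' \<tau> = 0" using \<Psi>_eq[OF T(1,2)] T(3) face_sign_nonzero[of \<tau> ?n, where 'k='k] by simp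
    then show "\<phi> \<tau> = 0" using \<tau> by (simp add: \<phi>'_def)
  qed
qed

text \<open>The remaining equations are recovered in three stages: complements of intervals of
  length \<open>k + 1\<close>, then the dropped ridges avoiding \<open>k + r\<close>, then the
  ridges containing \<open>k + r\<close>.\<close>

lemma cycle_if_boundary_zero_on_independent_ridges:
  fixes f :: "nat set \<Rightarrow> 'k::field"
  assumes k: "k \<ge> 3" and r: "r \<ge> 1"
    and supp: "\<And>F. F \<notin> facet_sets (k + r) r \<Longrightarrow> f F = 0"
    and zero: "\<And>\<tau>. \<tau> \<in> independent_ridges k r \<Longrightarrow> simplex_boundary {1..k + r} f \<tau> = 0"
  shows "simplex_boundary {1..k + r} f = (\<lambda>_. 0)"
proof (rule ext)
  fix \<tau> :: "nat set"
  let ?N = "{1..k + r}" and ?M = "{1..<k + r}" and ?n = "k + r"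
  let ?e = "simplex_boundary ?N f"
  have N: "?N = insert ?n ?M" using r by auto
  \<comment> \<open>Every coface has an interval minus a point as complement, which is gapless;
    hence no coface is a facet.\<close>
  have interval: "?e (?N - {a..a + k}) = 0" if a: "1 \<le> a" "a + k \<le> ?n" for a
    unfolding simplex_boundary_def
  proof (rule sum.neutral, rule ballI)
    fix v assume v: "v \<in> ?N - (?N - {a..a + k})"
    have "?N - insert v (?N - {a..a + k}) = {a..a + k} - {v}" using a by auto
    then have "insert v (?N - {a..a + k}) \<notin> facet_sets ?n r"
      by (simp add: facet_sets_def gapless_interval_minus_point)
    then show "face_sign (?N - {a..a + k}) v * f (insert v (?N - {a..a + k})) = 0"
      by (simp add: supp)
  qed
  have not_last: "?e \<tau> = 0" if \<tau>: "\<tau> \<subseteq> ?M" "card \<tau> = r - 1" for \<tau>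
  proof -
    have first: "?e (?M - {r..<?n}) = 0"
    proof -
      have "?M - {r..<?n} = ?N - {r..r + k}" by (auto simp: add.commute)
      then show ?thesis using interval[of r] r by simp
    qed
    have full: "\<tau> \<in> independent_ridges k r \<or> (\<exists>T\<in>dependent_complements k r. \<tau> = ?M - T)"
      if "\<tau> \<subseteq> ?M" "card \<tau> = r - 1" for \<tau>
      using that by (auto simp: independent_ridges_def)
    \<comment> \<open>The cofaces of \<open>?\<rho>\<close> come from adding \<open>?n\<close>,
      which gives the complement of the interval in \<open>?N\<close>, or a point \<open>u\<close>
      of the interval. All but \<open>u = a + k - 1\<close> are settled separately, so the exchange
      lemma settles that one.\<close>
    have dep: "?e (?M - ({a..a + k} - {a + k - 1})) = 0" if a: "a \<in> {1..<r}" for a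
    proof -
      let ?\<rho> = "?M - {a..a + k}"
      have I: "{a..a + k} \<subseteq> ?M" using a by auto
      have ins: "insert u ?\<rho> = ?M - ({a..a + k} - {u})" if "u \<in> {a..a + k}" for u
        using I that by blast
      have c: "a + k - 1 \<in> {a..a + k}" using k by simp
      have "?e (insert (a + k - 1) ?\<rho>) = 0"
      proof (rule simplex_boundary_exchange)
        show "finite ?N" "?\<rho> \<subseteq> ?N" by auto
        show "a + k - 1 \<in> ?N - ?\<rho>" using I c N by blast
        fix u assume u: "u \<in> ?N - ?\<rho>" "u \<noteq> a + k - 1"
        show "?e (insert u ?\<rho>) = 0"
        proof (cases "u = ?n")
          case True
          then have "insert u ?\<rho> = ?N - {a..a + k}" using I N by auto
          then show ?thesis using interval[of a] a by simp
        next
          case False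
          then have ua: "u \<in> {a..a + k}" using u by auto
          let ?X = "{a..a + k} - {u}"
          have X: "?X \<subseteq> ?M" "card ?X = k" using I ua by auto
          have "?M - ?X \<subseteq> ?M" "card (?M - ?X) = r - 1"
            using X by (auto simp: card_Diff_subset finite_subset[of _ ?M])
          from full[OF this] have "?e (?M - ?X) = 0"
          proof (elim disjE bexE)
            assume "?M - ?X \<in> independent_ridges k r"
            then show ?thesis by (rule zero)
          next
            fix T assume T: "T \<in> dependent_complements k r" and eq: "?M - ?X = ?M - T"
            from T r have "T \<subseteq> ?M" by (auto simp: dependent_complements_def)
            then have XT: "?X = T" using eq X(1) by blast
            from T consider "T = {r..<?n}" | b where "b \<in> {1..<r}" "T = {b..b + k} - {b + k - 1}"
              by (auto simp: dependent_complements_def)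
            then show ?thesis
            proof cases
              case 1
              then show ?thesis using first XT by simp
            next
              case 2
              \<comment> \<open>Both ends of \<open>{b..b + k}\<close> lie in
                \<open>{a..a + k}\<close>, so \<open>b = a\<close> and the missing point
                \<open>u\<close> is the excluded one.\<close>
              have "b \<in> T" "b + k \<in> T" "b + k - 1 \<notin> T" using k 2(2) by auto
              then have "b \<in> ?X" "b + k \<in> ?X" "b + k - 1 \<notin> ?X" unfolding XT by auto
              then have "a \<le> b" "b + k \<le> a + k" "b + k - 1 \<notin> ?X" by auto
              then have "a + k - 1 \<notin> ?X" by simp
              then have "u = a + k - 1" using c by blast
              with u(2) show ?thesis by simp
            qed
          qed
          then show ?thesis using ins[OF ua] by simp
        qed
      qed
      then show ?thesis using ins[OF c] by simp
    qed
    from full[OF \<tau>] show ?thesis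
    proof (elim disjE bexE)
      assume "\<tau> \<in> independent_ridges k r"
      then show ?thesis by (rule zero)
    next
      fix T assume T: "T \<in> dependent_complements k r" and eq: "\<tau> = ?M - T"
      then show ?thesis using first dep by (auto simp: dependent_complements_def)
    qed
  qed
  show "?e \<tau> = 0"
  proof (cases "\<tau> \<subseteq> ?N \<and> card \<tau> = r - 1")
    case True
    show ?thesis
    proof (cases "?n \<in> \<tau>")
      case False
      have "\<tau> \<subseteq> insert ?n ?M" using True unfolding N by (rule conjunct1)
      with False have "\<tau> \<subseteq> ?M" by blast
      then show ?thesis using True not_last by blast
    next
      case n: True
      have fin: "finite \<tau>" using True finite_subset by blast
      \<comment> \<open>Exchanging \<open>?n\<close> for any other vertex gives a ridge inside
        \<open>?M\<close>, where the coefficient is already known to vanish.\<close>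
      have "?e (insert ?n (\<tau> - {?n})) = 0"
      proof (rule simplex_boundary_exchange)
        show "finite ?N" "\<tau> - {?n} \<subseteq> ?N" "?n \<in> ?N - (\<tau> - {?n})" using True n by auto
        fix u assume u: "u \<in> ?N - (\<tau> - {?n})" "u \<noteq> ?n"
        show "?e (insert u (\<tau> - {?n})) = 0"
        proof (rule not_last)
          show "insert u (\<tau> - {?n}) \<subseteq> ?M" using True u unfolding N by auto
          have "card (insert u (\<tau> - {?n})) = Suc (card (\<tau> - {?n}))" using u fin by simp
          then show "card (insert u (\<tau> - {?n})) = r - 1" using card_Suc_Diff1[OF fin n] True by simp
        qed
      qed
      then show ?thesis using n by (simp add: insert_absorb)
    qed
  next
    case False
    have "insert v \<tau> \<notin> facet_sets ?n r" if "v \<in> ?N - \<tau>" for v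
    proof
      assume F: "insert v \<tau> \<in> facet_sets ?n r"
      then have "\<tau> \<subseteq> ?N" "card (insert v \<tau>) = r" by (auto simp: facet_sets_def)
      moreover from this have "finite \<tau>" using finite_subset by blast
      ultimately show False using False that by simp
    qed
    then show ?thesis unfolding simplex_boundary_def by (intro sum.neutral) (simp add: supp)
  qed
qed

section \<open>The Betti number as unknowns minus equations\<close>

lemma cut_facets_squared_path:
  assumes "k \<ge> 1"
  shows "cut_facets (squared_path (k + r)) k = facet_sets (k + r) r"
proof -
  let ?N = "{1..k + r}"
  have N: "pverts (squared_path (k + r)) = ?N" by (simp add: squared_path_def)
  have conn: "connected (with_proj (squared_path (k + r)) \<restriction> T) \<longleftrightarrow> gapless T"
    if "T \<subseteq> ?N" "card T = k" for T
    using that assms by (intro connected_squared_path_iff_gapless) auto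
  show ?thesis
  proof (intro equalityI subsetI)
    fix F assume "F \<in> cut_facets (squared_path (k + r)) k"
    then obtain T where T: "T \<subseteq> ?N" "card T = k" "\<not> gapless T" and F: "F = ?N - T"
      unfolding cut_facets_def N using conn by blast
    have "card F = r" using T F by (simp add: card_Diff_subset finite_subset[of _ ?N])
    moreover have "?N - F = T" using T F by blast
    ultimately show "F \<in> facet_sets (k + r) r" using T F by (simp add: facet_sets_def)
  next
    fix F assume "F \<in> facet_sets (k + r) r"
    then have F: "F \<subseteq> ?N" "card F = r" "\<not> gapless (?N - F)" by (auto simp: facet_sets_def)
    then have "card (?N - F) = k" by (simp add: card_Diff_subset finite_subset[of _ ?N])
    moreover have "F = ?N - (?N - F)" using F by blast
    ultimately show "F \<in> cut_facets (squared_path (k + r)) k"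
      unfolding cut_facets_def N using F conn[of "?N - F"] by blast
  qed
qed

text \<open>The degree is \<open>r - 1\<close>, the top one, so homology is the space of cycles: the
  facets are the unknowns and \<open>independent_ridges\<close> gives independent equations defining
  it. The additive form avoids truncated subtraction.\<close>

theorem cut_betti_plus:
  assumes k: "k \<ge> 3" and r: "r \<ge> 1"
  shows "cut_betti TYPE('k::field) k (k + r) + ((k + r - 1) choose (r - 1)) = card (facet_sets (k + r) r) + r"
proof -
  let ?N = "{1..k + r}"
  let ?U = "facet_sets (k + r) r" and ?C = "independent_ridges k r"
  let ?a = "incidence :: nat set \<Rightarrow> nat set \<Rightarrow> 'k"
  have U: "F \<subseteq> ?N \<and> card F = r \<and> finite F" if "F \<in> ?U" for F
    using that finite_subset[of F ?N] by (auto simp: facet_sets_def)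
  have UPow: "?U \<subseteq> Pow ?N" using U by blast
  have finC: "finite ?C"
    by (rule finite_subset[of _ "Pow {1..<k + r}"]) (auto simp: independent_ridges_def)
  have cycle_iff: "(\<forall>\<tau>\<in>?C. (\<Sum>F\<in>?U. ?a \<tau> F * f F) = 0) \<longleftrightarrow> simplex_boundary ?N f = (\<lambda>_. 0)"
    if f: "\<forall>F. F \<notin> ?U \<longrightarrow> f F = 0" for f
  proof -
    have eq: "(\<Sum>F\<in>?U. ?a \<tau> F * f F) = simplex_boundary ?N f \<tau>" for \<tau>
      using f by (intro sum_incidence_mult_chain UPow) auto
    show ?thesis unfolding eq
    proof
      assume "\<forall>\<tau>\<in>?C. simplex_boundary ?N f \<tau> = 0"
      then have "simplex_boundary ?N f \<tau> = 0" if "\<tau> \<in> ?C" for \<tau> using that by blast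
      with f[rule_format] show "simplex_boundary ?N f = (\<lambda>_. 0)"
        by (rule cycle_if_boundary_zero_on_independent_ridges[OF k r])
    qed simp
  qed
  obtain D where D: "D \<subseteq> ?U" "card D + card ?C = card ?U" and
    ex1: "\<And>h. \<exists>!f. (\<forall>F. F \<notin> ?U \<longrightarrow> f F = 0) \<and> (\<forall>\<tau>\<in>?C. (\<Sum>F\<in>?U. ?a \<tau> F * f F) = 0) \<and> (\<forall>F\<in>D. f F = h F)"
  proof -
    have "\<exists>D\<subseteq>?U. card D + card ?C = card ?U \<and> (\<forall>h. \<exists>!f. (\<forall>F. F \<notin> ?U \<longrightarrow> f F = 0) \<and>
        (\<forall>\<tau>\<in>?C. (\<Sum>F\<in>?U. ?a \<tau> F * f F) = 0) \<and> (\<forall>F\<in>D. f F = h F))"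
      by (rule independent_equations_solution_coordinates[OF finC finite_facet_sets])
        (rule independent_ridges_independent[OF k r])
    then show thesis by (elim exE conjE) (rule that, assumption+, erule spec)
  qed
  define K where "K = cut_complex (squared_path (k + r)) k"
  have K: "\<sigma> \<in> K \<longleftrightarrow> (\<exists>F\<in>?U. \<sigma> \<subseteq> F)" for \<sigma>
    using k by (simp add: K_def cut_complex_def cut_facets_squared_path)
  have KPow: "K \<subseteq> Pow ?N" using K U by blast
  have card_K: "card \<sigma> \<le> r" if "\<sigma> \<in> K" for \<sigma>
    using that U K card_mono by metis
  have K_top: "\<sigma> \<in> K \<and> card \<sigma> = r \<longleftrightarrow> \<sigma> \<in> ?U" for \<sigma>
  proof
    assume \<sigma>: "\<sigma> \<in> K \<and> card \<sigma> = r"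
    then obtain F where F: "F \<in> ?U" "\<sigma> \<subseteq> F" using K by blast
    then have "\<sigma> = F" using \<sigma> U[OF F(1)] by (intro card_subset_eq) auto
    with F show "\<sigma> \<in> ?U" by simp
  next
    assume "\<sigma> \<in> ?U"
    then show "\<sigma> \<in> K \<and> card \<sigma> = r" using K U by blast
  qed
  define d where "d = int (k + r) - int k - 1"
  define Z where "Z = {f :: nat set \<Rightarrow> 'k. (\<forall>F. F \<notin> ?U \<longrightarrow> f F = 0) \<and> simplex_boundary ?N f = (\<lambda>_. 0)}"
  have chains: "carrier (chain_module K d) = {f :: nat set \<Rightarrow> 'k. \<forall>F. F \<notin> ?U \<longrightarrow> f F = 0}"
    unfolding chain_module_def d_def using K_top by auto
  have boundary: "boundary_map K f = simplex_boundary ?N f" if "\<forall>F. F \<notin> ?U \<longrightarrow> f F = 0" for f :: "nat set \<Rightarrow> 'k"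
    by (rule boundary_map_eq_simplex_boundary[OF _ KPow]) (use that K_top in auto)
  have cycles: "cycles K d = Z"
    unfolding cycles_def chains Z_def using boundary by auto
  \<comment> \<open>Chains one degree higher would need faces with \<open>r + 1\<close> elements,
    and faces have at most \<open>r\<close>.\<close>
  have "carrier (chain_module K (d + 1)) = {\<lambda>_. 0 :: 'k}"
  proof -
    have "\<not> (\<sigma> \<in> K \<and> int (card \<sigma>) = d + 1 + 1)" for \<sigma>
      using card_K[of \<sigma>] by (auto simp: d_def)
    then show ?thesis unfolding chain_module_def by auto
  qed
  then have boundaries: "boundaries K d = {\<lambda>_. 0 :: 'k}"
    by (simp add: boundaries_def boundary_map_def)
  have "cut_betti TYPE('k) k (k + r) =
      vectorspace.dim class_ring (quotient_module ((chain_module K d)\<lparr>carrier := Z\<rparr>) {\<lambda>_. 0})"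
    unfolding cut_betti_def reduced_betti_def reduced_homology_def K_def[symmetric] d_def[symmetric]
      cycles boundaries ..
  also have "\<dots> = card D"
  proof (rule dim_quotient_by_zero)
    show "(\<lambda>_. 0) \<in> Z" by (simp add: Z_def simplex_boundary_def fun_eq_iff)
    show "(\<lambda>u. f u + g u) \<in> Z" if "f \<in> Z" "g \<in> Z" for f g
    proof -
      have "simplex_boundary ?N (\<lambda>u. f u + g u) = (\<lambda>\<tau>. simplex_boundary ?N f \<tau> + simplex_boundary ?N g \<tau>)"
        by (simp add: simplex_boundary_def fun_eq_iff distrib_left sum.distrib)
      then show ?thesis using that by (simp add: Z_def)
    qed
    show "(\<lambda>u. x * f u) \<in> Z" if "f \<in> Z" for x f
    proof -
      have "simplex_boundary ?N (\<lambda>u. x * f u) = (\<lambda>\<tau>. x * simplex_boundary ?N f \<tau>)"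
        by (simp add: simplex_boundary_def fun_eq_iff sum_distrib_left mult.left_commute)
      then show ?thesis using that by (simp add: Z_def)
    qed
    show "finite D" using D(1) finite_facet_sets finite_subset by blast
    fix h :: "nat set \<Rightarrow> 'k"
    have "f \<in> Z \<and> (\<forall>F\<in>D. f F = h F) \<longleftrightarrow>
        (\<forall>F. F \<notin> ?U \<longrightarrow> f F = 0) \<and> (\<forall>\<tau>\<in>?C. (\<Sum>F\<in>?U. ?a \<tau> F * f F) = 0) \<and> (\<forall>F\<in>D. f F = h F)" for f
      using cycle_iff[of f] unfolding Z_def by (simp only: mem_Collect_eq conj_assoc cong: conj_cong)
    then show "\<exists>!f. f \<in> Z \<and> (\<forall>F\<in>D. f F = h F)" using ex1[of h] by presburger
  qed
  finally show ?thesis using D(2) card_independent_ridges[OF k r] by simp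
qed

section \<open>Counting gapless sets\<close>

definition gapless_upto :: "nat \<Rightarrow> nat \<Rightarrow> nat set set" where
  "gapless_upto k m = {T. T \<subseteq> {1..m} \<and> card T = k \<and> gapless T}"

definition gapless_ending :: "nat \<Rightarrow> nat \<Rightarrow> nat set set" where
  "gapless_ending k m = {T \<in> gapless_upto k m. m \<in> T}"

lemma finite_gapless_upto: "finite (gapless_upto k m)"
  by (rule finite_subset[of _ "Pow {1..m}"]) (auto simp: gapless_upto_def)

lemma finite_gapless_ending: "finite (gapless_ending k m)"
  using finite_gapless_upto[of k m] by (simp add: gapless_ending_def)

lemma gapless_insert_above:
  assumes "gapless T" "x \<in> T" "\<And>t. t \<in> T \<Longrightarrow> t \<le> x" "y = x + 1 \<or> y = x + 2"
  shows "gapless (insert y T)"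
  unfolding gapless_alt
proof (intro ballI impI)
  fix t assume t: "t \<in> insert y T" and "\<exists>z\<in>insert y T. t < z"
  moreover have "t \<le> y" if "t \<in> insert y T" for t using that assms(3)[of t] assms(4) by auto
  ultimately have "t \<noteq> y" by force
  then have tT: "t \<in> T" using t by simp
  show "t + 1 \<in> insert y T \<or> t + 2 \<in> insert y T"
  proof (cases "t = x")
    case True
    then show ?thesis using assms(4) by auto
  next
    case False
    then have "t < x" using assms(3)[OF tT] by simp
    then show ?thesis using assms(1,2) tT unfolding gapless_alt by blast
  qed
qed

lemma gapless_remove_max:
  assumes g: "gapless T" and fin: "finite T" and m: "m \<in> T" "\<And>t. t \<in> T \<Longrightarrow> t \<le> m" and ne: "T - {m} \<noteq> {}"
  obtains y where "m = y + 1 \<or> m = y + 2" "y \<in> T - {m}" "\<And>t. t \<in> T - {m} \<Longrightarrow> t \<le> y" "gapless (T - {m})"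
proof -
  define y where "y = Max (T - {m})"
  have y: "y \<in> T - {m}" "\<And>t. t \<in> T - {m} \<Longrightarrow> t \<le> y"
    using fin ne Max_in[of "T - {m}"] Max_ge[of "T - {m}"] by (auto simp: y_def)
  have ym: "y < m" using y(1) m(2)[of y] by auto
  have "y + 1 \<in> T \<or> y + 2 \<in> T" using g y(1) ym m(1) unfolding gapless_alt by blast
  moreover have top: "t = m" if "t \<in> T" "y < t" for t using y(2)[of t] that by (cases "t = m") auto
  ultimately have step: "m = y + 1 \<or> m = y + 2" using top[of "y + 1"] top[of "y + 2"] by auto
  have "gapless (T - {m})" unfolding gapless_alt
  proof (intro ballI impI)
    fix x assume x: "x \<in> T - {m}" and "\<exists>z\<in>T - {m}. x < z"
    then obtain z where z: "z \<in> T - {m}" "x < z" by blast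
    then have zm: "z < m" using m(2)[of z] by auto
    have "x + 1 \<in> T \<or> x + 2 \<in> T" using g x z unfolding gapless_alt by blast
    then show "x + 1 \<in> T - {m} \<or> x + 2 \<in> T - {m}"
    proof (elim disjE)
      assume "x + 1 \<in> T"
      then show ?thesis using z zm by auto
    next
      assume "x + 2 \<in> T"
      show ?thesis
      proof (cases "x + 2 = m")
        case True
        then have "z = x + 1" using z zm by simp
        then show ?thesis using z by simp
      next
        case False
        then show ?thesis using \<open>x + 2 \<in> T\<close> by simp
      qed
    qed
  qed
  note gap = this
  show ?thesis
  proof (rule that)
    show "m = y + 1 \<or> m = y + 2" "y \<in> T - {m}" "gapless (T - {m})" by (fact step y(1) gap)+
    fix t assume "t \<in> T - {m}"
    then show "t \<le> y" by (rule y(2))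
  qed
qed

text \<open>After removal of the largest element, the next one must be one or two below it;
  \<open>k \<ge> 1\<close> ensures that there is a next one.\<close>

lemma gapless_ending_Suc:
  assumes "k \<ge> 1"
  shows "gapless_ending (Suc k) (m + 2) = insert (m + 2) ` (gapless_ending k (m + 1) \<union> gapless_ending k m)"
proof (intro equalityI subsetI)
  fix T assume "T \<in> gapless_ending (Suc k) (m + 2)"
  then have T: "T \<subseteq> {1..m + 2}" "card T = Suc k" "gapless T" "m + 2 \<in> T"
    by (auto simp: gapless_ending_def gapless_upto_def)
  have fin: "finite T" using T(1) finite_subset by blast
  have c: "card (T - {m + 2}) = k" using T fin by simp
  have le: "t \<le> m + 2" if "t \<in> T" for t using T(1) that by auto
  have ne: "T - {m + 2} \<noteq> {}"
  proof
    assume e: "T - {m + 2} = {}"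
    from c assms show False unfolding e by simp
  qed
  from gapless_remove_max[OF T(3) fin T(4) le ne]
  obtain y where y: "m + 2 = y + 1 \<or> m + 2 = y + 2" "y \<in> T - {m + 2}"
    "\<And>t. t \<in> T - {m + 2} \<Longrightarrow> t \<le> y" "gapless (T - {m + 2})" by blast
  have "T - {m + 2} \<subseteq> {1..y}" using T(1) y(3) by fastforce
  then have "T - {m + 2} \<in> gapless_ending k y"
    using c y(2,4) by (simp add: gapless_ending_def gapless_upto_def)
  moreover have "y = m + 1 \<or> y = m" using y(1) by auto
  ultimately have "T - {m + 2} \<in> gapless_ending k (m + 1) \<union> gapless_ending k m" by blast
  moreover have "T = insert (m + 2) (T - {m + 2})" using T(4) by blast
  ultimately show "T \<in> insert (m + 2) ` (gapless_ending k (m + 1) \<union> gapless_ending k m)" by blast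
next
  fix T assume "T \<in> insert (m + 2) ` (gapless_ending k (m + 1) \<union> gapless_ending k m)"
  then obtain y S where y: "m + 2 = y + 1 \<or> m + 2 = y + 2" and S: "S \<in> gapless_ending k y"
    and T: "T = insert (m + 2) S" by auto
  have S': "S \<subseteq> {1..y}" "card S = k" "gapless S" "y \<in> S"
    using S by (auto simp: gapless_ending_def gapless_upto_def)
  have "m + 2 \<notin> S" using S'(1) y by auto
  then have "card T = Suc k" using S' T finite_subset[of S "{1..y}"] by simp
  moreover have "gapless T" unfolding T
    by (rule gapless_insert_above[OF S'(3,4) _ y]) (use S'(1) in auto)
  moreover have "T \<subseteq> {1..m + 2}" using S'(1) T y by auto
  ultimately show "T \<in> gapless_ending (Suc k) (m + 2)" using T by (simp add: gapless_ending_def gapless_upto_def)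
qed

lemma gapless_ending_eq_empty: "m < k \<Longrightarrow> gapless_ending k m = {}"
proof -
  assume "m < k"
  have "card T \<le> m" if "T \<subseteq> {1..m}" for T using card_mono[OF _ that] by simp
  then have "\<not> (T \<subseteq> {1..m} \<and> card T = k)" for T using \<open>m < k\<close> by (metis not_less)
  then show ?thesis unfolding gapless_ending_def gapless_upto_def by blast
qed

lemma card_gapless_ending_Suc:
  assumes "k \<ge> 1"
  shows "card (gapless_ending (Suc k) (m + 2)) = card (gapless_ending k (m + 1)) + card (gapless_ending k m)"
proof -
  let ?U = "gapless_ending k (m + 1) \<union> gapless_ending k m"
  have "m + 2 \<notin> S" if "S \<in> ?U" for S
    using that by (auto simp: gapless_ending_def gapless_upto_def)
  then have "inj_on (insert (m + 2)) ?U" by (intro inj_onI) (metis insert_ident)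
  moreover have "gapless_ending k (m + 1) \<inter> gapless_ending k m = {}"
    by (auto simp: gapless_ending_def gapless_upto_def)
  ultimately show ?thesis unfolding gapless_ending_Suc[OF assms]
    by (simp add: card_image card_Un_disjoint finite_gapless_ending)
qed

text \<open>If \<open>i\<close> of the \<open>k\<close> steps have length 2, the least element is
  \<open>1 + j - i\<close>, which is positive iff \<open>i \<le> j\<close>. The induction confirms
  the count through Pascal's rule.\<close>

lemma card_gapless_ending:
  "card (gapless_ending (Suc k) (Suc k + j)) = (\<Sum>i\<le>j. k choose i)"
proof (induction k arbitrary: j)
  case 0
  have "gapless_ending 1 (1 + j) = {{1 + j}}"
    by (auto simp: gapless_ending_def gapless_upto_def card_1_singleton_iff gapless_def hole_def)
  moreover have "(\<Sum>i\<le>j. 0 choose i) = 1"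
    by (induction j) auto
  ultimately show ?case by simp
next
  case (Suc k)
  show ?case
  proof (cases j)
    case 0
    have "card (gapless_ending (Suc (Suc k)) (k + 2)) = card (gapless_ending (Suc k) (k + 1)) + card (gapless_ending (Suc k) k)"
      by (rule card_gapless_ending_Suc) simp
    then show ?thesis using Suc.IH[of 0] 0 by (simp add: gapless_ending_eq_empty)
  next
    case (Suc j')
    have "card (gapless_ending (Suc (Suc k)) (Suc k + j' + 2)) =
        card (gapless_ending (Suc k) (Suc k + j' + 1)) + card (gapless_ending (Suc k) (Suc k + j'))"
      by (rule card_gapless_ending_Suc) simp
    also have "\<dots> = (\<Sum>i\<le>Suc j'. k choose i) + (\<Sum>i\<le>j'. k choose i)"
      using Suc.IH[of "Suc j'"] Suc.IH[of j'] by simp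
    also have "\<dots> = (\<Sum>i\<le>Suc j'. Suc k choose i)"
      by (simp only: sum.atMost_Suc_shift binomial_Suc_Suc sum.distrib binomial_n_0)
    finally show ?thesis using Suc by simp
  qed
qed

text \<open>The sets are sorted by their largest element, which is at least
  \<open>Suc k\<close>.\<close>

lemma card_gapless_upto:
  "card (gapless_upto (Suc k) (Suc k + r)) = (\<Sum>j\<le>r. \<Sum>i\<le>j. k choose i)"
proof (induction r)
  case 0
  have "Suc k \<in> T" if "T \<subseteq> {1..Suc k}" "card T = Suc k" for T
  proof -
    have "T = {1..Suc k}" using that by (intro card_subset_eq) auto
    then show ?thesis by simp
  qed
  then have "gapless_upto (Suc k) (Suc k) = gapless_ending (Suc k) (Suc k)"
    by (auto simp: gapless_ending_def gapless_upto_def)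
  then show ?case using card_gapless_ending[of k 0] by simp
next
  case (Suc r)
  have "gapless_upto (Suc k) (Suc (Suc k + r)) =
      gapless_upto (Suc k) (Suc k + r) \<union> gapless_ending (Suc k) (Suc (Suc k + r))"
    by (auto simp: gapless_ending_def gapless_upto_def atLeastAtMostSuc_conv subset_insert)
  moreover have "gapless_upto (Suc k) (Suc k + r) \<inter> gapless_ending (Suc k) (Suc (Suc k + r)) = {}"
    by (auto simp: gapless_ending_def gapless_upto_def)
  ultimately have "card (gapless_upto (Suc k) (Suc (Suc k + r))) =
      card (gapless_upto (Suc k) (Suc k + r)) + card (gapless_ending (Suc k) (Suc (Suc k + r)))"
    by (simp only: card_Un_disjoint[OF finite_gapless_upto finite_gapless_ending])
  then show ?case using Suc.IH card_gapless_ending[of k "Suc r"] by simp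
qed

lemma card_facet_sets:
  assumes "k \<ge> 1"
  shows "card (facet_sets (k + r) r) + (\<Sum>j\<le>r. \<Sum>i\<le>j. (k - 1) choose i) = (k + r) choose r"
proof -
  let ?N = "{1..k + r}"
  let ?all = "{T. T \<subseteq> ?N \<and> card T = k}"
  have gap: "gapless_upto k (k + r) \<subseteq> ?all" by (auto simp: gapless_upto_def)
  have fin: "finite ?all" by (rule finite_subset[of _ "Pow ?N"]) auto
  have "bij_betw (\<lambda>F. ?N - F) (facet_sets (k + r) r) (?all - gapless_upto k (k + r))"
  proof (rule bij_betw_byWitness[where f' = "\<lambda>T. ?N - T"])
    show "(\<lambda>F. ?N - F) ` facet_sets (k + r) r \<subseteq> ?all - gapless_upto k (k + r)"
    proof (rule image_subsetI)
      fix F assume "F \<in> facet_sets (k + r) r"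
      then have F: "F \<subseteq> ?N" "card F = r" "\<not> gapless (?N - F)" by (simp_all add: facet_sets_def)
      then have "card (?N - F) = k" by (simp add: card_Diff_subset finite_subset[of _ ?N])
      with F(3) show "?N - F \<in> ?all - gapless_upto k (k + r)" by (simp add: gapless_upto_def)
    qed
    show "(\<lambda>T. ?N - T) ` (?all - gapless_upto k (k + r)) \<subseteq> facet_sets (k + r) r"
    proof (rule image_subsetI)
      fix T assume "T \<in> ?all - gapless_upto k (k + r)"
      then have T: "T \<subseteq> ?N" "card T = k" "\<not> gapless T" by (simp_all add: gapless_upto_def)
      then have "card (?N - T) = r" by (simp add: card_Diff_subset finite_subset[of _ ?N])
      moreover have "?N - (?N - T) = T" using T(1) by blast
      ultimately show "?N - T \<in> facet_sets (k + r) r" using T(3) by (simp add: facet_sets_def)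
    qed
    show "\<forall>F\<in>facet_sets (k + r) r. ?N - (?N - F) = F" unfolding facet_sets_def by blast
    show "\<forall>T\<in>?all - gapless_upto k (k + r). ?N - (?N - T) = T" by blast
  qed
  then have "card (facet_sets (k + r) r) = card (?all - gapless_upto k (k + r))"
    by (rule bij_betw_same_card)
  also have "\<dots> = card ?all - card (gapless_upto k (k + r))"
    using gap fin by (simp add: card_Diff_subset finite_gapless_upto)
  finally have "card (facet_sets (k + r) r) + card (gapless_upto k (k + r)) = card ?all"
    using card_mono[OF fin gap] by simp
  moreover have "card ?all = (k + r) choose r"
    using n_subsets[of ?N k] binomial_symmetric[of k "k + r"] by simp
  moreover have "card (gapless_upto k (k + r)) = (\<Sum>j\<le>r. \<Sum>i\<le>j. (k - 1) choose i)"
    using card_gapless_upto[of "k - 1" r] assms by simp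
  ultimately show ?thesis by simp
qed

section \<open>Iterated backward differences\<close>

lemma funpow_Suc_backward_diff:
  "(backward_diff ^^ Suc r) f k = (backward_diff ^^ r) f k - (backward_diff ^^ r) f (k - 1)"
  by (simp only: funpow.simps comp_apply backward_diff_def[of "(backward_diff ^^ r) f" k])

text \<open>Pascal's rule for the coefficients. No bound on \<open>k\<close> is required, since
  \<open>k - 1 - i = k - Suc i\<close> also holds for truncated subtraction.\<close>

lemma funpow_backward_diff_eq_sum:
  "(backward_diff ^^ r) f k = (\<Sum>i\<le>r. (-1) ^ i * int (r choose i) * f (k - i))"
proof (induction r arbitrary: k)
  case (Suc r)
  let ?c = "\<lambda>r i. (-1) ^ i * int (r choose i)"
  have "(\<Sum>i\<le>Suc r. ?c (Suc r) i * f (k - i)) =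
      f k + (\<Sum>i\<le>r. ?c (Suc r) (Suc i) * f (k - Suc i))"
    by (simp only: sum.atMost_Suc_shift) simp
  also have "\<dots> = f k + (\<Sum>i\<le>r. ?c r (Suc i) * f (k - Suc i)) - (\<Sum>i\<le>r. ?c r i * f (k - Suc i))"
  proof -
    have "?c (Suc r) (Suc i) * f (k - Suc i) = ?c r (Suc i) * f (k - Suc i) - ?c r i * f (k - Suc i)" for i
      by (simp add: algebra_simps)
    then show ?thesis by (simp only: sum_subtractf add_diff_eq)
  qed
  also have "f k + (\<Sum>i\<le>r. ?c r (Suc i) * f (k - Suc i)) = (\<Sum>i\<le>Suc r. ?c r i * f (k - i))"
    by (simp only: sum.atMost_Suc_shift) simp
  also have "\<dots> = (\<Sum>i\<le>r. ?c r i * f (k - i))" by simp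
  finally show ?case by (simp only: funpow_Suc_backward_diff Suc.IH diff_diff_left plus_1_eq_Suc)
qed simp

text \<open>By Pascal's rule each difference lowers both arguments of the binomial by one; once the
  lower one is 0 the function is constant and the next difference is 0.\<close>

lemma funpow_backward_diff_binomial:
  assumes "r \<le> a"
  shows "(backward_diff ^^ r) (\<lambda>x. int (x choose j)) a = (if r \<le> j then int ((a - r) choose (j - r)) else 0)"
  using assms
proof (induction r arbitrary: a)
  case (Suc r)
  have a: "a - r = Suc (a - Suc r)" "a - 1 - r = a - Suc r" using Suc.prems by auto
  have *: "(backward_diff ^^ Suc r) (\<lambda>x. int (x choose j)) a =
      (if r \<le> j then int ((a - r) choose (j - r)) else 0) - (if r \<le> j then int ((a - 1 - r) choose (j - r)) else 0)"
    using Suc.IH[of a] Suc.IH[of "a - 1"] Suc.prems by (simp only: funpow_Suc_backward_diff)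
  show ?case
  proof (cases "Suc r \<le> j")
    case True
    then have "j - r = Suc (j - Suc r)" by simp
    then show ?thesis unfolding * a using True by simp
  next
    case False
    then show ?thesis unfolding * a by (cases "r = j") auto
  qed
qed simp

section \<open>The recurrence\<close>

text \<open>Pascal's rule merges the number of \<open>k\<close>-sets and the number of ridges
  avoiding \<open>k + r\<close> into one binomial.\<close>

lemma cut_betti_diag_eq:
  assumes "k \<ge> 3" "r \<ge> 1"
  shows "cut_betti_diag TYPE('k::field) r k =
    int ((k + r - 1) choose r) - (\<Sum>j\<le>r. \<Sum>i\<le>j. int ((k - 1) choose i)) + int r"
proof -
  have "(k + r) choose r = ((k + r - 1) choose (r - 1)) + ((k + r - 1) choose r)"
    using assms by (intro choose_reduce_nat) auto
  moreover have "card (facet_sets (k + r) r) + (\<Sum>j\<le>r. \<Sum>i\<le>j. (k - 1) choose i) = (k + r) choose r"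
    by (rule card_facet_sets) (use assms in simp)
  moreover have "cut_betti TYPE('k) k (k + r) + ((k + r - 1) choose (r - 1)) = card (facet_sets (k + r) r) + r"
    by (rule cut_betti_plus[OF assms])
  ultimately have "int (cut_betti TYPE('k) k (k + r)) =
      int ((k + r - 1) choose r) - int (\<Sum>j\<le>r. \<Sum>i\<le>j. (k - 1) choose i) + int r"
    by linarith
  then show ?thesis by (simp add: cut_betti_diag_def)
qed

lemma sum_alternating_binomial:
  assumes "r \<le> a"
  shows "(\<Sum>i\<le>r. (-1) ^ i * int (r choose i) * int ((a - i) choose j)) =
    (if r \<le> j then int ((a - r) choose (j - r)) else 0)"
  using funpow_backward_diff_binomial[OF assms, of j] unfolding funpow_backward_diff_eq_sum .

text \<open>The leading binomial contributes 1, as does the term \<open>j = l = r\<close> of the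
  double sum, and they cancel; every other term has degree below \<open>r\<close>. The bound on
  \<open>k\<close> keeps \<open>k - i \<ge> 3\<close>, so the closed form applies
  throughout.\<close>

lemma sum_alternating_cut_betti_diag:
  assumes r: "r \<ge> 1" and k: "k \<ge> r + 3"
  shows "(\<Sum>i\<le>r. (-1) ^ i * int (r choose i) * cut_betti_diag TYPE('k::field) r (k - i)) = 0"
proof -
  let ?c = "\<lambda>i. (-1) ^ i * int (r choose i)"
  let ?b = "\<lambda>i j. int ((k - 1 - i) choose j)"
  \<comment> \<open>The constant \<open>r\<close> is written with \<open>?b i 0\<close>, which
    equals 1, so that it too is covered by \<open>sum_alternating_binomial\<close>.\<close>
  have "(\<Sum>i\<le>r. ?c i * cut_betti_diag TYPE('k) r (k - i)) =
      (\<Sum>i\<le>r. ?c i * int ((k + r - 1 - i) choose r) - (\<Sum>j\<le>r. \<Sum>l\<le>j. ?c i * ?b i l) + int r * (?c i * ?b i 0))"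
  proof (rule sum.cong[OF refl])
    fix i assume "i \<in> {..r}"
    then have "k - i \<ge> 3" "k - i + r - 1 = k + r - 1 - i" "k - i - 1 = k - 1 - i" using k by auto
    then show "?c i * cut_betti_diag TYPE('k) r (k - i) =
        ?c i * int ((k + r - 1 - i) choose r) - (\<Sum>j\<le>r. \<Sum>l\<le>j. ?c i * ?b i l) + int r * (?c i * ?b i 0)"
      using cut_betti_diag_eq[of "k - i" r, where 'k='k] r
      by (simp add: sum_distrib_left right_diff_distrib distrib_left)
  qed
  also have "\<dots> = (\<Sum>i\<le>r. ?c i * int ((k + r - 1 - i) choose r))
      - (\<Sum>j\<le>r. \<Sum>l\<le>j. \<Sum>i\<le>r. ?c i * ?b i l) + int r * (\<Sum>i\<le>r. ?c i * ?b i 0)"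
  proof -
    have "(\<Sum>i\<le>r. \<Sum>j\<le>r. \<Sum>l\<le>j. ?c i * ?b i l) = (\<Sum>j\<le>r. \<Sum>i\<le>r. \<Sum>l\<le>j. ?c i * ?b i l)"
      by (rule sum.swap)
    also have "\<dots> = (\<Sum>j\<le>r. \<Sum>l\<le>j. \<Sum>i\<le>r. ?c i * ?b i l)"
      by (rule sum.cong[OF refl]) (rule sum.swap)
    finally show ?thesis by (simp only: sum.distrib sum_subtractf sum_distrib_left)
  qed
  also have "(\<Sum>i\<le>r. ?c i * int ((k + r - 1 - i) choose r)) = 1"
    using sum_alternating_binomial[of r "k + r - 1" r] k by simp
  also have "(\<Sum>j\<le>r. \<Sum>l\<le>j. \<Sum>i\<le>r. ?c i * ?b i l) = (\<Sum>j\<le>r. if j = r then 1 else 0)"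
  proof (rule sum.cong[OF refl])
    fix j assume j: "j \<in> {..r}"
    have "(\<Sum>l\<le>j. \<Sum>i\<le>r. ?c i * ?b i l) = (\<Sum>l\<le>j. if l = r then 1 else 0)"
    proof (rule sum.cong[OF refl])
      fix l assume "l \<in> {..j}"
      then show "(\<Sum>i\<le>r. ?c i * ?b i l) = (if l = r then 1 else 0)"
        using sum_alternating_binomial[of r "k - 1" l] k j by auto
    qed
    then show "(\<Sum>l\<le>j. \<Sum>i\<le>r. ?c i * ?b i l) = (if j = r then 1 else 0)"
      using j by simp
  qed
  also have "(\<Sum>i\<le>r. ?c i * ?b i 0) = 0"
    using sum_alternating_binomial[of r "k - 1" 0] r k by simp
  finally show ?thesis by simp
qed

theorem theorem6p2:
  fixes r k :: nat
  assumes "r \<ge> 3" and "k \<ge> r + 3"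
  shows "int (cut_betti TYPE('k::field) k (k + r)) =
           (\<Sum>i = 1..r. (-1) ^ (i - 1) * int (r choose i) * int (cut_betti TYPE('k) (k - i) (k - i + r)))
       \<and> (backward_diff ^^ r) (cut_betti_diag TYPE('k) r) k =
           (\<Sum>i = 0..r. (-1) ^ i * int (r choose i) * cut_betti_diag TYPE('k) r (k - i))
       \<and> (\<Sum>i = 0..r. (-1) ^ i * int (r choose i) * cut_betti_diag TYPE('k) r (k - i)) = 0"
proof (intro conjI)
  show zero: "(\<Sum>i = 0..r. (-1) ^ i * int (r choose i) * cut_betti_diag TYPE('k) r (k - i)) = 0"
    using sum_alternating_cut_betti_diag[of r k, where 'k='k] assms by (simp add: atLeast0AtMost)
  show "(backward_diff ^^ r) (cut_betti_diag TYPE('k) r) k =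
      (\<Sum>i = 0..r. (-1) ^ i * int (r choose i) * cut_betti_diag TYPE('k) r (k - i))"
    unfolding atLeast0AtMost by (rule funpow_backward_diff_eq_sum)
  have "(\<Sum>i = 1..r. (-1) ^ (i - 1) * int (r choose i) * int (cut_betti TYPE('k) (k - i) (k - i + r))) =
      (\<Sum>i = 1..r. - ((-1) ^ i * int (r choose i) * cut_betti_diag TYPE('k) r (k - i)))"
  proof (rule sum.cong[OF refl])
    fix i assume "i \<in> {1..r}"
    \<comment> \<open>As \<open>i\<close> is positive, \<open>i - 1\<close> is not truncated and the
      two signs are opposite.\<close>
    then obtain i' where "i = Suc i'" by (cases i) auto
    then show "(-1) ^ (i - 1) * int (r choose i) * int (cut_betti TYPE('k) (k - i) (k - i + r)) =
        - ((-1) ^ i * int (r choose i) * cut_betti_diag TYPE('k) r (k - i))"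
      by (simp add: cut_betti_diag_def)
  qed
  moreover have "(\<Sum>i = 0..r. (-1) ^ i * int (r choose i) * cut_betti_diag TYPE('k) r (k - i)) =
      cut_betti_diag TYPE('k) r k + (\<Sum>i = 1..r. (-1) ^ i * int (r choose i) * cut_betti_diag TYPE('k) r (k - i))"
    by (simp add: sum.atLeast_Suc_atMost)
  ultimately show "int (cut_betti TYPE('k) k (k + r)) =
      (\<Sum>i = 1..r. (-1) ^ (i - 1) * int (r choose i) * int (cut_betti TYPE('k) (k - i) (k - i + r)))"
    using zero by (simp add: sum_negf cut_betti_diag_def)
qed

end
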